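(* Let $X$ be the Dynkin diagram of a symmetrizable generalized Cartan matrix. Let $\Lambda$ be a proper subdiagram of $X$ and let $\Lambda'$ be the subdiagram formed by the vertices of $X$ not in $\Lambda$. Let $\Sigma$ and $\Sigma'$ be $\pi$-systems in $\Lambda$ and $\Lambda'$ respectively, consisting of positive real roots. Then $\Sigma\cup\Sigma'$ is a $\pi$-system in $X$.
   Context: A $\pi$-system in a Dynkin diagram (or generalized Cartan matrix) is a finite set of distinct real roots $\{\beta_i\}_{i=1}^m$ of the corresponding Kac-Moody algebra such that $\beta_i-\beta_j$ is not a root for any $i\neq j$. A subdiagram of $X$ is the diagram induced on a subset of its vertices; the roots of a subdiagram are regarded as elements of the root lattice of $X$ in the natural way (the simple roots of the subdiagram being the corresponding simple roots of $X$). *)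

theory Defs
  imports Complex_Main
begin

section \<open>Complex Lie algebras given by generators and relations\<close>

datatype (gens: 'g) lie_expr =
    Gen 'g
  | Zero
  | Add "'g lie_expr" "'g lie_expr"
  | Scale complex "'g lie_expr"
  | Bracket "'g lie_expr" "'g lie_expr"

definition lie_exprs :: "'g set \<Rightarrow> 'g lie_expr set" where
  "lie_exprs S = {x. gens x \<subseteq> S}"

text \<open>The quotient of \<open>lie_exprs S\<close> by \<open>lie_cong S R\<close> is the complex Lie algebra with generators
  \<open>S\<close> and defining relations \<open>R\<close>.  Below, elements of that algebra are always represented by
  expressions.\<close>

inductive lie_cong ::
    "'g set \<Rightarrow> ('g lie_expr \<times> 'g lie_expr) set \<Rightarrow> 'g lie_expr \<Rightarrow> 'g lie_expr \<Rightarrow> bool"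
  for S R where
  refl: "x \<in> lie_exprs S \<Longrightarrow> lie_cong S R x x"
| sym: "lie_cong S R x y \<Longrightarrow> lie_cong S R y x"
| trans: "lie_cong S R x y \<Longrightarrow> lie_cong S R y z \<Longrightarrow> lie_cong S R x z"
| Add_cong: "lie_cong S R x x' \<Longrightarrow> lie_cong S R y y' \<Longrightarrow> lie_cong S R (Add x y) (Add x' y')"
| Scale_cong: "lie_cong S R x x' \<Longrightarrow> lie_cong S R (Scale c x) (Scale c x')"
| Bracket_cong:
    "lie_cong S R x x' \<Longrightarrow> lie_cong S R y y' \<Longrightarrow> lie_cong S R (Bracket x y) (Bracket x' y')"
| relation:
    "(x, y) \<in> R \<Longrightarrow> x \<in> lie_exprs S \<Longrightarrow> y \<in> lie_exprs S \<Longrightarrow> lie_cong S R x y"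
| Add_assoc:
    "x \<in> lie_exprs S \<Longrightarrow> y \<in> lie_exprs S \<Longrightarrow> z \<in> lie_exprs S \<Longrightarrow>
     lie_cong S R (Add (Add x y) z) (Add x (Add y z))"
| Add_comm:
    "x \<in> lie_exprs S \<Longrightarrow> y \<in> lie_exprs S \<Longrightarrow> lie_cong S R (Add x y) (Add y x)"
| Add_Zero: "x \<in> lie_exprs S \<Longrightarrow> lie_cong S R (Add x Zero) x"
| Add_inverse: "x \<in> lie_exprs S \<Longrightarrow> lie_cong S R (Add x (Scale (-1) x)) Zero"
| Scale_Add:
    "x \<in> lie_exprs S \<Longrightarrow> y \<in> lie_exprs S \<Longrightarrow>
     lie_cong S R (Scale c (Add x y)) (Add (Scale c x) (Scale c y))"
| Scale_plus:
    "x \<in> lie_exprs S \<Longrightarrow> lie_cong S R (Scale (c + d) x) (Add (Scale c x) (Scale d x))"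
| Scale_Scale: "x \<in> lie_exprs S \<Longrightarrow> lie_cong S R (Scale c (Scale d x)) (Scale (c * d) x)"
| Scale_one: "x \<in> lie_exprs S \<Longrightarrow> lie_cong S R (Scale 1 x) x"
| Bracket_Add_left:
    "x \<in> lie_exprs S \<Longrightarrow> y \<in> lie_exprs S \<Longrightarrow> z \<in> lie_exprs S \<Longrightarrow>
     lie_cong S R (Bracket (Add x y) z) (Add (Bracket x z) (Bracket y z))"
| Bracket_Add_right:
    "x \<in> lie_exprs S \<Longrightarrow> y \<in> lie_exprs S \<Longrightarrow> z \<in> lie_exprs S \<Longrightarrow>
     lie_cong S R (Bracket x (Add y z)) (Add (Bracket x y) (Bracket x z))"
| Bracket_Scale_left:
    "x \<in> lie_exprs S \<Longrightarrow> y \<in> lie_exprs S \<Longrightarrow>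
     lie_cong S R (Bracket (Scale c x) y) (Scale c (Bracket x y))"
| Bracket_Scale_right:
    "x \<in> lie_exprs S \<Longrightarrow> y \<in> lie_exprs S \<Longrightarrow>
     lie_cong S R (Bracket x (Scale c y)) (Scale c (Bracket x y))"
| Bracket_self: "x \<in> lie_exprs S \<Longrightarrow> lie_cong S R (Bracket x x) Zero"
| Jacobi:
    "x \<in> lie_exprs S \<Longrightarrow> y \<in> lie_exprs S \<Longrightarrow> z \<in> lie_exprs S \<Longrightarrow>
     lie_cong S R
       (Add (Bracket x (Bracket y z)) (Add (Bracket y (Bracket z x)) (Bracket z (Bracket x y))))
       Zero"

definition lie_ideal ::
    "'g set \<Rightarrow> ('g lie_expr \<times> 'g lie_expr) set \<Rightarrow> 'g lie_expr set \<Rightarrow> bool" where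
  "lie_ideal S R J \<longleftrightarrow>
     J \<subseteq> lie_exprs S \<and> Zero \<in> J \<and>
     (\<forall>x\<in>J. \<forall>y. lie_cong S R x y \<longrightarrow> y \<in> J) \<and>
     (\<forall>x\<in>J. \<forall>y\<in>J. Add x y \<in> J) \<and>
     (\<forall>x\<in>J. \<forall>c. Scale c x \<in> J) \<and>
     (\<forall>x\<in>J. \<forall>y\<in>lie_exprs S. Bracket y x \<in> J)"


section \<open>Generalized Cartan matrices and their realizations\<close>

text \<open>A matrix with rows and columns indexed by a finite vertex set \<open>I\<close> is a function
  \<open>A\<close> of which only the entries \<open>A i j\<close> with \<open>i, j \<in> I\<close> matter.  The diagram induced on
  \<open>\<Lambda> \<subseteq> I\<close> is therefore given by the same \<open>A\<close> together with the vertex set \<open>\<Lambda>\<close>.\<close>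

definition gcm :: "('i \<Rightarrow> 'i \<Rightarrow> int) \<Rightarrow> 'i set \<Rightarrow> bool" where
  "gcm A I \<longleftrightarrow> finite I \<and>
     (\<forall>i\<in>I. A i i = 2) \<and>
     (\<forall>i\<in>I. \<forall>j\<in>I. i \<noteq> j \<longrightarrow> A i j \<le> 0) \<and>
     (\<forall>i\<in>I. \<forall>j\<in>I. A i j = 0 \<longrightarrow> A j i = 0)"

text \<open>\<open>A = D B\<close> with \<open>D\<close> an invertible diagonal and \<open>B\<close> a symmetric matrix.\<close>

definition symmetrizable :: "('i \<Rightarrow> 'i \<Rightarrow> int) \<Rightarrow> 'i set \<Rightarrow> bool" where
  "symmetrizable A I \<longleftrightarrow>
     (\<exists>(d :: 'i \<Rightarrow> complex) (B :: 'i \<Rightarrow> 'i \<Rightarrow> complex).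
        (\<forall>i\<in>I. d i \<noteq> 0) \<and>
        (\<forall>i\<in>I. \<forall>j\<in>I. B i j = B j i) \<and>
        (\<forall>i\<in>I. \<forall>j\<in>I. of_int (A i j) = d i * B i j))"

definition lin_indep_family :: "'i set \<Rightarrow> 'k set \<Rightarrow> ('i \<Rightarrow> 'k \<Rightarrow> complex) \<Rightarrow> bool" where
  "lin_indep_family J K v \<longleftrightarrow>
     (\<forall>c. (\<forall>k\<in>K. (\<Sum>i\<in>J. c i * v i k) = 0) \<longrightarrow> (\<forall>i\<in>J. c i = 0))"

definition matrix_rank :: "('i \<Rightarrow> 'i \<Rightarrow> int) \<Rightarrow> 'i set \<Rightarrow> nat" where
  "matrix_rank A I =
     Max {card J | J. J \<subseteq> I \<and> lin_indep_family J I (\<lambda>i j. of_int (A i j))}"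

text \<open>A realization in coordinates: the Cartan subalgebra is \<open>\<complex>\<^sup>m\<close> with \<open>m = cartan_dim \<rho>\<close>,
  simple coroots are vectors, and simple roots are linear forms given by their coefficients.\<close>

record 'i realization =
  cartan_dim :: nat
  simple_coroot :: "'i \<Rightarrow> nat \<Rightarrow> complex"
  simple_form :: "'i \<Rightarrow> nat \<Rightarrow> complex"

definition cartan :: "'i realization \<Rightarrow> (nat \<Rightarrow> complex) set" where
  "cartan \<rho> = {h. \<forall>k\<ge>cartan_dim \<rho>. h k = 0}"

definition pairing :: "'i realization \<Rightarrow> 'i \<Rightarrow> (nat \<Rightarrow> complex) \<Rightarrow> complex" where
  "pairing \<rho> i h = (\<Sum>k<cartan_dim \<rho>. simple_form \<rho> i k * h k)"

definition is_realization :: "('i \<Rightarrow> 'i \<Rightarrow> int) \<Rightarrow> 'i set \<Rightarrow> 'i realization \<Rightarrow> bool" where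
  "is_realization A I \<rho> \<longleftrightarrow>
     (\<forall>i\<in>I. simple_coroot \<rho> i \<in> cartan \<rho>) \<and>
     lin_indep_family I {..<cartan_dim \<rho>} (simple_coroot \<rho>) \<and>
     lin_indep_family I {..<cartan_dim \<rho>} (simple_form \<rho>) \<and>
     (\<forall>i\<in>I. \<forall>j\<in>I. pairing \<rho> j (simple_coroot \<rho> i) = of_int (A i j)) \<and>
     cartan_dim \<rho> + matrix_rank A I = 2 * card I"

text \<open>Realizations are unique up to isomorphism; they exist by \<open>realization_exists\<close> below.\<close>

definition the_realization :: "('i \<Rightarrow> 'i \<Rightarrow> int) \<Rightarrow> 'i set \<Rightarrow> 'i realization" where
  "the_realization A I = (SOME \<rho>. is_realization A I \<rho>)"

lemma realization_exists:
  fixes A :: "'i \<Rightarrow> 'i \<Rightarrow> int"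
  assumes fin: "finite I"
  shows "\<exists>\<rho>. is_realization A I \<rho>"
proof -
  let ?S = "{card J | J. J \<subseteq> I \<and> lin_indep_family J I (\<lambda>i j. of_int (A i j))}"
  let ?n = "card I"
  have "lin_indep_family {} I (\<lambda>i j. of_int (A i j))"
    by (simp add: lin_indep_family_def)
  then have ne: "?S \<noteq> {}"
    by blast
  have "?S \<subseteq> card ` Pow I"
    by blast
  then have "finite ?S"
    using fin by (meson finite_Pow_iff finite_imageI finite_subset)
  then have "matrix_rank A I \<in> ?S"
    unfolding matrix_rank_def using ne by (rule Max_in)
  then obtain J where J: "J \<subseteq> I" "lin_indep_family J I (\<lambda>i j. of_int (A i j))"
      and cJ: "card J = matrix_rank A I"
    by auto
  define m where "m = ?n + card (I - J)"
  have finJ: "finite J"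
    using J(1) fin finite_subset by blast
  have cIJ: "card J + card (I - J) = ?n"
    using J(1) fin finJ by (metis card_Diff_subset card_mono le_add_diff_inverse)
  obtain f where f: "bij_betw f I {..<?n}"
    using ex_bij_betw_finite_nat[OF fin] by (auto simp: atLeast0LessThan)
  obtain g0 where g0: "bij_betw g0 (I - J) {0..<card (I - J)}"
    using ex_bij_betw_finite_nat[of "I - J"] fin by blast
  define g where "g i = ?n + g0 i" for i
  have g_inj: "inj_on g (I - J)"
    using g0 by (auto simp: g_def bij_betw_def inj_on_def)
  have g_range: "?n \<le> g i" "g i < m" if "i \<in> I - J" for i
    using bij_betwE[OF g0] that by (auto simp: g_def m_def)
  have f_lt: "f i < ?n" if "i \<in> I" for i
    using bij_betwE[OF f] that by auto
  have f_lt_m: "f i < m" if "i \<in> I" for i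
    using f_lt[OF that] by (simp add: m_def)
  have f_inj: "inj_on f I"
    using f by (rule bij_betw_imp_inj_on)
  define cr :: "'i \<Rightarrow> nat \<Rightarrow> complex" where
    "cr i k = (if k < ?n then of_int (A i (inv_into I f k))
               else if i \<in> I - J \<and> k = g i then 1 else 0)" for i k
  define fm :: "'i \<Rightarrow> nat \<Rightarrow> complex" where
    "fm i k = (if k = f i then 1 else 0)" for i k
  define \<rho> where "\<rho> = \<lparr>cartan_dim = m, simple_coroot = cr, simple_form = fm\<rparr>"
  have sel [simp]: "cartan_dim \<rho> = m" "simple_coroot \<rho> = cr" "simple_form \<rho> = fm"
    by (simp_all add: \<rho>_def)
  have cr_f: "cr i (f j) = of_int (A i j)" if "j \<in> I" for i j
    using that f_lt f_inj by (simp add: cr_def inv_into_f_f)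
  have 1: "cr i \<in> cartan \<rho>" if "i \<in> I" for i
    using g_range(2) by (fastforce simp: cartan_def cr_def m_def)
  have 2: "lin_indep_family I {..<m} cr"
    unfolding lin_indep_family_def
  proof (intro allI impI)
    fix c
    assume z: "\<forall>k\<in>{..<m}. (\<Sum>i\<in>I. c i * cr i k) = 0"
    have out: "c i = 0" if i: "i \<in> I - J" for i
    proof -
      have "(\<Sum>j\<in>I. c j * cr j (g i)) = (\<Sum>j\<in>I. if j = i then c i else 0)"
      proof (rule sum.cong)
        fix j assume "j \<in> I"
        show "c j * cr j (g i) = (if j = i then c i else 0)"
          using g_range[OF i] i inj_onD[OF g_inj, of i j] by (auto simp: cr_def)
      qed simp
      also have "\<dots> = c i"
        using i fin by simp
      finally show ?thesis
        using z g_range[OF i] by simp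
    qed
    have "(\<Sum>i\<in>J. c i * of_int (A i j)) = 0" if j: "j \<in> I" for j
    proof -
      have "(\<Sum>i\<in>J. c i * of_int (A i j)) = (\<Sum>i\<in>I. c i * cr i (f j))"
        using J(1) fin out by (intro sum.mono_neutral_cong_left) (auto simp: cr_f[OF j])
      then show ?thesis
        using z f_lt_m[OF j] by simp
    qed
    then have "\<forall>i\<in>J. c i = 0"
      using J(2) unfolding lin_indep_family_def by blast
    then show "\<forall>i\<in>I. c i = 0"
      using out by blast
  qed
  have 3: "lin_indep_family I {..<m} fm"
    unfolding lin_indep_family_def
  proof (intro allI impI ballI)
    fix c i
    assume z: "\<forall>k\<in>{..<m}. (\<Sum>i\<in>I. c i * fm i k) = 0" and i: "i \<in> I"
    have "(\<Sum>j\<in>I. c j * fm j (f i)) = (\<Sum>j\<in>I. if j = i then c i else 0)"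
      using inj_onD[OF f_inj _ i] by (intro sum.cong) (auto simp: fm_def)
    also have "\<dots> = c i"
      using i fin by simp
    finally show "c i = 0"
      using z f_lt_m[OF i] by simp
  qed
  have 4: "pairing \<rho> j (cr i) = of_int (A i j)" if "j \<in> I" for i j
  proof -
    have "pairing \<rho> j (cr i) = (\<Sum>k<m. if k = f j then cr i k else 0)"
      unfolding pairing_def by (intro sum.cong) (auto simp: fm_def)
    also have "\<dots> = cr i (f j)"
      using f_lt_m[OF that] by simp
    finally show ?thesis
      using cr_f[OF that] by simp
  qed
  have 5: "m + matrix_rank A I = 2 * ?n"
    using cIJ cJ by (simp add: m_def)
  have "is_realization A I \<rho>"
    unfolding is_realization_def using 1 2 3 4 5 by simp
  then show ?thesis ..
qed

lemma is_realization_the_realization: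
  "finite I \<Longrightarrow> is_realization A I (the_realization A I)"
  unfolding the_realization_def by (rule someI_ex) (rule realization_exists)


section \<open>Kac--Moody algebras\<close>

datatype 'i km_gen = E 'i | F 'i | H "nat \<Rightarrow> complex"

definition km_gens :: "'i set \<Rightarrow> 'i realization \<Rightarrow> 'i km_gen set" where
  "km_gens I \<rho> = E ` I \<union> F ` I \<union> H ` cartan \<rho>"

text \<open>The first two families of relations say that \<open>H\<close> embeds the Cartan subalgebra linearly.\<close>

definition km_relations ::
    "'i set \<Rightarrow> 'i realization \<Rightarrow> ('i km_gen lie_expr \<times> 'i km_gen lie_expr) set" where
  "km_relations I \<rho> =
     {(Add (Gen (H h)) (Gen (H h')), Gen (H (\<lambda>k. h k + h' k))) | h h'.
        h \<in> cartan \<rho> \<and> h' \<in> cartan \<rho>} \<union>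
     {(Scale c (Gen (H h)), Gen (H (\<lambda>k. c * h k))) | c h. h \<in> cartan \<rho>} \<union>
     {(Bracket (Gen (H h)) (Gen (H h')), Zero) | h h'. h \<in> cartan \<rho> \<and> h' \<in> cartan \<rho>} \<union>
     {(Bracket (Gen (E i)) (Gen (F i)), Gen (H (simple_coroot \<rho> i))) | i. i \<in> I} \<union>
     {(Bracket (Gen (E i)) (Gen (F j)), Zero) | i j. i \<in> I \<and> j \<in> I \<and> i \<noteq> j} \<union>
     {(Bracket (Gen (H h)) (Gen (E i)), Scale (pairing \<rho> i h) (Gen (E i))) | h i.
        h \<in> cartan \<rho> \<and> i \<in> I} \<union>
     {(Bracket (Gen (H h)) (Gen (F i)), Scale (- pairing \<rho> i h) (Gen (F i))) | h i.
        h \<in> cartan \<rho> \<and> i \<in> I}"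

definition meets_cartan_trivially ::
    "'i set \<Rightarrow> 'i realization \<Rightarrow> 'i km_gen lie_expr set \<Rightarrow> bool" where
  "meets_cartan_trivially I \<rho> J \<longleftrightarrow>
     (\<forall>h\<in>cartan \<rho>. Gen (H h) \<in> J \<longrightarrow>
        lie_cong (km_gens I \<rho>) (km_relations I \<rho>) (Gen (H h)) Zero)"

text \<open>The largest ideal meeting the Cartan subalgebra trivially.  Such a largest ideal exists
  (ideals are graded by the root lattice), so it is the union of all ideals of this kind.  The
  Kac--Moody algebra is \<open>lie_exprs (km_gens I \<rho>)\<close> modulo this ideal.\<close>

definition km_radical :: "'i set \<Rightarrow> 'i realization \<Rightarrow> 'i km_gen lie_expr set" where
  "km_radical I \<rho> =
     \<Union>{J. lie_ideal (km_gens I \<rho>) (km_relations I \<rho>) J \<and> meets_cartan_trivially I \<rho> J}"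


section \<open>Roots\<close>

text \<open>An element \<open>\<Sum>\<^sub>i \<alpha> i \<alpha>\<^sub>i\<close> of the root lattice is given by its coefficients.  The root
  lattice of a subdiagram is thereby contained in that of the whole diagram.\<close>

definition root_lattice :: "'i set \<Rightarrow> ('i \<Rightarrow> int) set" where
  "root_lattice I = {\<alpha>. \<forall>i. i \<notin> I \<longrightarrow> \<alpha> i = 0}"

definition root_eval :: "'i set \<Rightarrow> 'i realization \<Rightarrow> ('i \<Rightarrow> int) \<Rightarrow> (nat \<Rightarrow> complex) \<Rightarrow> complex" where
  "root_eval I \<rho> \<alpha> h = (\<Sum>i\<in>I. of_int (\<alpha> i) * pairing \<rho> i h)"

text \<open>Representatives of the elements of the root space of \<open>\<alpha>\<close> in the Kac--Moody algebra.\<close>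

definition root_space ::
    "'i set \<Rightarrow> 'i realization \<Rightarrow> ('i \<Rightarrow> int) \<Rightarrow> 'i km_gen lie_expr set" where
  "root_space I \<rho> \<alpha> =
     {x \<in> lie_exprs (km_gens I \<rho>).
        \<forall>h\<in>cartan \<rho>.
          Add (Bracket (Gen (H h)) x) (Scale (- root_eval I \<rho> \<alpha> h) x) \<in> km_radical I \<rho>}"

definition roots :: "('i \<Rightarrow> 'i \<Rightarrow> int) \<Rightarrow> 'i set \<Rightarrow> ('i \<Rightarrow> int) set" where
  "roots A I =
     {\<alpha> \<in> root_lattice I. \<alpha> \<noteq> (\<lambda>_. 0) \<and>
        \<not> root_space I (the_realization A I) \<alpha> \<subseteq> km_radical I (the_realization A I)}"

definition simple_root :: "'i \<Rightarrow> 'i \<Rightarrow> int" where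
  "simple_root i = (\<lambda>j. if j = i then 1 else 0)"

definition reflection ::
    "('i \<Rightarrow> 'i \<Rightarrow> int) \<Rightarrow> 'i set \<Rightarrow> 'i \<Rightarrow> ('i \<Rightarrow> int) \<Rightarrow> ('i \<Rightarrow> int)" where
  "reflection A I i \<alpha> = (\<lambda>j. \<alpha> j - (\<Sum>k\<in>I. A i k * \<alpha> k) * simple_root i j)"

text \<open>The Weyl group acting on the root lattice.  Simple reflections are involutions there, so
  closure under inverses is automatic.\<close>

inductive_set weyl_group ::
    "('i \<Rightarrow> 'i \<Rightarrow> int) \<Rightarrow> 'i set \<Rightarrow> (('i \<Rightarrow> int) \<Rightarrow> ('i \<Rightarrow> int)) set"
  for A I where
  one: "id \<in> weyl_group A I"
| mult: "i \<in> I \<Longrightarrow> w \<in> weyl_group A I \<Longrightarrow> reflection A I i \<circ> w \<in> weyl_group A I"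

definition real_roots :: "('i \<Rightarrow> 'i \<Rightarrow> int) \<Rightarrow> 'i set \<Rightarrow> ('i \<Rightarrow> int) set" where
  "real_roots A I = {\<alpha> \<in> roots A I. \<exists>w\<in>weyl_group A I. \<exists>i\<in>I. w \<alpha> = simple_root i}"

definition positive_real_roots :: "('i \<Rightarrow> 'i \<Rightarrow> int) \<Rightarrow> 'i set \<Rightarrow> ('i \<Rightarrow> int) set" where
  "positive_real_roots A I = {\<alpha> \<in> real_roots A I. \<forall>i\<in>I. 0 \<le> \<alpha> i}"

definition pi_system :: "('i \<Rightarrow> 'i \<Rightarrow> int) \<Rightarrow> 'i set \<Rightarrow> ('i \<Rightarrow> int) set \<Rightarrow> bool" where
  "pi_system A I S \<longleftrightarrow> finite S \<and> S \<subseteq> real_roots A I \<and>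
     (\<forall>\<beta>\<in>S. \<forall>\<gamma>\<in>S. \<beta> \<noteq> \<gamma> \<longrightarrow> (\<lambda>i. \<beta> i - \<gamma> i) \<notin> roots A I)"

end

theory Submission
  imports Defs
begin

text \<open>The algebra given by the presentation acts on the Verma-type modules generated freely by the
  \<open>F i\<close> from a highest weight vector, and its radical consists exactly of the elements all of whose
  matrix coefficients against the vacuum vanish, for all highest weights.  Together with the
  triangular decomposition this shows that the roots are the weights of the iterated brackets of
  the \<open>E i\<close> alone, or of the \<open>F i\<close> alone, that are not in the radical.  The matrix coefficients of such
  a bracket depend only on the Cartan integers of the letters occurring in it, so the roots of a
  subdiagram are the roots of the diagram supported on it.  A difference of positive roots with
  disjoint supports has coefficients of both signs, hence is not a root.\<close>

section \<open>Lie algebras by generators and relations\<close>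

text \<open>The obstacle is that the algebra of \<open>\<Lambda>\<close> is not given inside that of
  X. Each has its own arbitrarily chosen realization, with Cartan subalgebras of different dimension
  in general, and its own radical, a union of ideals of its own presentation; inclusion of
  generators gives no evident map of the quotients. The proof compares complex numbers instead.
  Matrix coefficients of nested brackets see the Cartan subalgebra only through the values of the
  highest weight on simple coroots, and as these are linearly independent in every realization, a
  highest weight for one can be matched by one for another. All highest weights are tested at once
  because a single one can be degenerate: for weight 0, \<open>E i\<close> after \<open>F i\<close>
  kills the highest weight vector. The modules enter through their duals, functions of words acted
  on from the right, where \<open>F i\<close> is a shift and \<open>E i\<close> a recursion on the
  word. The triangular decomposition enters as a spanning statement; components are separated by a
  weight filter and by matrix coefficients.\<close>

lemma lie_exprs_simps [simp]:
  "Gen g \<in> lie_exprs S \<longleftrightarrow> g \<in> S"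
  "Zero \<in> lie_exprs S"
  "Add x y \<in> lie_exprs S \<longleftrightarrow> x \<in> lie_exprs S \<and> y \<in> lie_exprs S"
  "Scale c x \<in> lie_exprs S \<longleftrightarrow> x \<in> lie_exprs S"
  "Bracket x y \<in> lie_exprs S \<longleftrightarrow> x \<in> lie_exprs S \<and> y \<in> lie_exprs S"
  by (auto simp: lie_exprs_def)

lemma lie_cong_exprs:
  "lie_cong S R x y \<Longrightarrow> x \<in> lie_exprs S \<and> y \<in> lie_exprs S"
  by (induction rule: lie_cong.induct) auto

declare lie_cong.trans [trans]

lemma Scale_0:
  assumes "x \<in> lie_exprs S"
  shows "lie_cong S R (Scale 0 x) Zero"
proof -
  have "lie_cong S R (Scale (1 + (-1)) x) (Add (Scale 1 x) (Scale (-1) x))"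
    using assms by (rule lie_cong.Scale_plus)
  also have "lie_cong S R (Add (Scale 1 x) (Scale (-1) x)) (Add x (Scale (-1) x))"
    using assms by (intro lie_cong.Add_cong lie_cong.Scale_one lie_cong.refl) auto
  also have "lie_cong S R (Add x (Scale (-1) x)) Zero"
    using assms by (rule lie_cong.Add_inverse)
  finally show ?thesis by simp
qed

lemma Scale_Zero: "lie_cong S R (Scale c Zero) Zero"
proof -
  have "lie_cong S R (Scale c Zero) (Scale c (Scale 0 Zero))"
    by (intro lie_cong.Scale_cong lie_cong.sym[OF Scale_0]) auto
  also have "lie_cong S R (Scale c (Scale 0 Zero)) (Scale (c * 0) Zero)"
    by (rule lie_cong.Scale_Scale) auto
  also have "lie_cong S R (Scale (c * 0) Zero) Zero"
    using Scale_0[of Zero S R] by simp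
  finally show ?thesis .
qed

lemma Bracket_Zero:
  assumes "x \<in> lie_exprs S"
  shows "lie_cong S R (Bracket x Zero) Zero"
proof -
  have "lie_cong S R (Bracket x Zero) (Bracket x (Scale 0 Zero))"
    using assms by (intro lie_cong.Bracket_cong lie_cong.sym[OF Scale_0] lie_cong.refl) auto
  also have "lie_cong S R (Bracket x (Scale 0 Zero)) (Scale 0 (Bracket x Zero))"
    using assms by (intro lie_cong.Bracket_Scale_right) auto
  also have "lie_cong S R (Scale 0 (Bracket x Zero)) Zero"
    using assms by (intro Scale_0) auto
  finally show ?thesis .
qed

lemma Zero_Add:
  assumes "x \<in> lie_exprs S"
  shows "lie_cong S R (Add Zero x) x"
  using assms by (meson lie_cong.Add_Zero lie_cong.Add_comm lie_cong.trans lie_exprs_simps(2))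

lemma eq_if_diff_Zero:
  assumes "a \<in> lie_exprs S" "b \<in> lie_exprs S"
    and z: "lie_cong S R (Add a (Scale (-1) b)) Zero"
  shows "lie_cong S R a b"
proof -
  have bb: "lie_cong S R (Add (Scale (-1) b) b) Zero"
    using assms by (meson lie_cong.Add_comm lie_cong.Add_inverse lie_cong.trans lie_exprs_simps(4))
  have "lie_cong S R a (Add a Zero)"
    using assms by (intro lie_cong.sym[OF lie_cong.Add_Zero])
  also have "lie_cong S R (Add a Zero) (Add a (Add (Scale (-1) b) b))"
    using assms by (intro lie_cong.Add_cong lie_cong.refl lie_cong.sym[OF bb])
  also have "lie_cong S R (Add a (Add (Scale (-1) b) b)) (Add (Add a (Scale (-1) b)) b)"
    using assms by (intro lie_cong.sym[OF lie_cong.Add_assoc]) auto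
  also have "lie_cong S R (Add (Add a (Scale (-1) b)) b) (Add Zero b)"
    using assms by (intro lie_cong.Add_cong lie_cong.refl z)
  also have "lie_cong S R (Add Zero b) b"
    using assms by (intro Zero_Add)
  finally show ?thesis .
qed

lemma Bracket_antisym:
  assumes x: "x \<in> lie_exprs S" and y: "y \<in> lie_exprs S"
  shows "lie_cong S R (Bracket x y) (Scale (-1) (Bracket y x))"
proof -
  let ?eq = "lie_cong S R"
  \<comment> \<open>Polarization: these are the mixed terms of the bracket of \<open>Add x y\<close>
    with itself.\<close>
  have "?eq (Add (Bracket x y) (Bracket y x)) (Add (Add Zero (Bracket x y)) (Add (Bracket y x) Zero))"
    using x y by (intro lie_cong.Add_cong lie_cong.sym[OF lie_cong.Add_Zero] lie_cong.sym[OF Zero_Add]) auto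
  also have "?eq \<dots> (Add (Add (Bracket x x) (Bracket x y)) (Add (Bracket y x) (Bracket y y)))"
    using x y by (intro lie_cong.Add_cong lie_cong.sym[OF lie_cong.Bracket_self] lie_cong.refl) auto
  also have "?eq \<dots> (Add (Bracket x (Add x y)) (Bracket y (Add x y)))"
    using x y by (intro lie_cong.Add_cong lie_cong.sym[OF lie_cong.Bracket_Add_right]) auto
  also have "?eq \<dots> (Bracket (Add x y) (Add x y))"
    using x y by (intro lie_cong.sym[OF lie_cong.Bracket_Add_left]) auto
  also have "?eq \<dots> Zero"
    using x y by (intro lie_cong.Bracket_self) auto
  finally have z: "?eq (Add (Bracket x y) (Bracket y x)) Zero" .
  have "?eq (Scale (-1) (Scale (-1) (Bracket y x))) (Scale ((-1) * (-1)) (Bracket y x))"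
    using x y by (intro lie_cong.Scale_Scale) auto
  also have "?eq \<dots> (Bracket y x)"
    using x y lie_cong.Scale_one[of "Bracket y x" S R] by auto
  finally have "?eq (Scale (-1) (Scale (-1) (Bracket y x))) (Bracket y x)" .
  then have "?eq (Add (Bracket x y) (Scale (-1) (Scale (-1) (Bracket y x)))) (Add (Bracket x y) (Bracket y x))"
    using x y by (intro lie_cong.Add_cong lie_cong.refl) auto
  then have "?eq (Add (Bracket x y) (Scale (-1) (Scale (-1) (Bracket y x)))) Zero"
    using z by (rule lie_cong.trans)
  then show ?thesis
    by (rule eq_if_diff_Zero[rotated 2]) (use x y in auto)
qed

lemma Jacobi_Leibniz:
  assumes x: "x \<in> lie_exprs S" and y: "y \<in> lie_exprs S" and z: "z \<in> lie_exprs S"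
  shows "lie_cong S R (Bracket x (Bracket y z))
    (Add (Bracket (Bracket x y) z) (Bracket y (Bracket x z)))"
proof -
  let ?eq = "lie_cong S R"
  let ?b = "Bracket (Bracket x y) z" and ?c = "Bracket y (Bracket x z)"
  have c: "?eq (Scale (-1) ?c) (Bracket y (Bracket z x))"
  proof -
    have "?eq (Bracket y (Bracket z x)) (Bracket y (Scale (-1) (Bracket x z)))"
      using x y z by (intro lie_cong.Bracket_cong lie_cong.refl Bracket_antisym) auto
    also have "?eq \<dots> (Scale (-1) ?c)"
      using x y z by (intro lie_cong.Bracket_Scale_right) auto
    finally show ?thesis by (rule lie_cong.sym)
  qed
  have b: "?eq (Scale (-1) ?b) (Bracket z (Bracket x y))"
    using x y z by (intro lie_cong.sym[OF Bracket_antisym]) auto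
  have "?eq (Scale (-1) (Add ?b ?c)) (Add (Scale (-1) ?b) (Scale (-1) ?c))"
    using x y z by (intro lie_cong.Scale_Add) auto
  also have "?eq \<dots> (Add (Bracket z (Bracket x y)) (Bracket y (Bracket z x)))"
    by (intro lie_cong.Add_cong b c)
  also have "?eq \<dots> (Add (Bracket y (Bracket z x)) (Bracket z (Bracket x y)))"
    using x y z by (intro lie_cong.Add_comm) auto
  finally have "?eq (Add (Bracket x (Bracket y z)) (Scale (-1) (Add ?b ?c)))
     (Add (Bracket x (Bracket y z)) (Add (Bracket y (Bracket z x)) (Bracket z (Bracket x y))))"
    using x y z by (intro lie_cong.Add_cong lie_cong.refl) auto
  also have "?eq \<dots> Zero"
    using x y z by (rule lie_cong.Jacobi)
  finally show ?thesis
    by (rule eq_if_diff_Zero[rotated 2]) (use x y z in auto)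
qed

lemma Scale_cong_Zero:
  assumes "lie_cong S R x Zero"
  shows "lie_cong S R (Scale c x) Zero"
  using assms Scale_Zero lie_cong.Scale_cong lie_cong.trans by metis

lemma weight_Bracket:
  assumes h: "h \<in> lie_exprs S"
    and x: "lie_cong S R (Bracket h x) (Scale a x)"
    and y: "lie_cong S R (Bracket h y) (Scale b y)"
  shows "lie_cong S R (Bracket h (Bracket x y)) (Scale (a + b) (Bracket x y))"
proof -
  let ?eq = "lie_cong S R"
  have xy: "x \<in> lie_exprs S" "y \<in> lie_exprs S"
    using lie_cong_exprs[OF x] lie_cong_exprs[OF y] by auto
  have "?eq (Bracket h (Bracket x y)) (Add (Bracket (Bracket h x) y) (Bracket x (Bracket h y)))"
    using h xy by (rule Jacobi_Leibniz)
  also have "?eq \<dots> (Add (Bracket (Scale a x) y) (Bracket x (Scale b y)))"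
    using xy by (intro lie_cong.Add_cong lie_cong.Bracket_cong x y lie_cong.refl)
  also have "?eq \<dots> (Add (Scale a (Bracket x y)) (Scale b (Bracket x y)))"
    using xy by (intro lie_cong.Add_cong lie_cong.Bracket_Scale_left lie_cong.Bracket_Scale_right)
  also have "?eq \<dots> (Scale (a + b) (Bracket x y))"
    using xy by (intro lie_cong.sym[OF lie_cong.Scale_plus]) auto
  finally show ?thesis .
qed

text \<open>The quotient algebra is not formed as a type, so a subspace of it is a predicate on
  representatives. The rule \<open>cong\<close> makes it independent of the representative.\<close>

inductive lie_span ::
    "'g set \<Rightarrow> ('g lie_expr \<times> 'g lie_expr) set \<Rightarrow> 'g lie_expr set \<Rightarrow> 'g lie_expr \<Rightarrow> bool"
  for S R B where
  base: "x \<in> B \<Longrightarrow> x \<in> lie_exprs S \<Longrightarrow> lie_span S R B x"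
| Zero: "lie_span S R B Zero"
| Add: "lie_span S R B x \<Longrightarrow> lie_span S R B y \<Longrightarrow> lie_span S R B (Add x y)"
| Scale: "lie_span S R B x \<Longrightarrow> lie_span S R B (Scale c x)"
| cong: "lie_span S R B x \<Longrightarrow> lie_cong S R y x \<Longrightarrow> lie_span S R B y"

lemma lie_span_exprs: "lie_span S R B x \<Longrightarrow> x \<in> lie_exprs S"
  by (induction rule: lie_span.induct) (auto dest: lie_cong_exprs)

lemma lie_span_mono: "lie_span S R B x \<Longrightarrow> B \<subseteq> B' \<Longrightarrow> lie_span S R B' x"
  by (induction rule: lie_span.induct) (auto intro: lie_span.intros)

lemma lie_span_Bracket_right:
  assumes x: "x \<in> lie_exprs S"
    and B: "\<And>b. b \<in> B \<Longrightarrow> b \<in> lie_exprs S \<Longrightarrow> lie_span S R B' (Bracket x b)"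
    and "lie_span S R B y"
  shows "lie_span S R B' (Bracket x y)"
  using assms(3)
proof (induction rule: lie_span.induct)
  case (base y)
  then show ?case by (rule B)
next
  case Zero
  show ?case by (rule lie_span.cong[OF lie_span.Zero Bracket_Zero[OF x]])
next
  case (Add y z)
  show ?case
    by (rule lie_span.cong[OF lie_span.Add lie_cong.Bracket_Add_right])
      (use Add x in \<open>auto dest: lie_span_exprs\<close>)
next
  case (Scale y c)
  show ?case
    by (rule lie_span.cong[OF lie_span.Scale lie_cong.Bracket_Scale_right])
      (use Scale x in \<open>auto dest: lie_span_exprs\<close>)
next
  case (cong y z)
  show ?case
    by (rule lie_span.cong[OF cong.IH lie_cong.Bracket_cong[OF lie_cong.refl[OF x] cong.hyps(2)]])
qed

lemma lie_span_Bracket_swap: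
  "x \<in> lie_exprs S \<Longrightarrow> y \<in> lie_exprs S \<Longrightarrow> lie_span S R B (Bracket x y) \<Longrightarrow>
    lie_span S R B (Bracket y x)"
  by (rule lie_span.cong[OF lie_span.Scale Bracket_antisym])

lemma lie_span_Bracket_left:
  assumes x: "x \<in> lie_exprs S"
    and B: "\<And>b. b \<in> B \<Longrightarrow> b \<in> lie_exprs S \<Longrightarrow> lie_span S R B' (Bracket b x)"
    and y: "lie_span S R B y"
  shows "lie_span S R B' (Bracket y x)"
proof -
  have *: "lie_span S R B' (Bracket x b)" if "b \<in> B" "b \<in> lie_exprs S" for b
    using that(2) x B[OF that] by (rule lie_span_Bracket_swap)
  show ?thesis
    by (rule lie_span_Bracket_swap[OF x lie_span_exprs[OF y] lie_span_Bracket_right[OF x * y]])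
qed

lemma lie_span_Add_cancel:
  assumes bc: "lie_span S R B (Add b c)" and c: "lie_span S R B c"
  shows "lie_span S R B b"
proof -
  have b: "b \<in> lie_exprs S" and c': "c \<in> lie_exprs S"
    using lie_span_exprs[OF bc] by auto
  have "lie_cong S R (Add (Add b c) (Scale (-1) c)) (Add b (Add c (Scale (-1) c)))"
    using b c' by (intro lie_cong.Add_assoc) auto
  also have "lie_cong S R \<dots> (Add b Zero)"
    using b c' by (intro lie_cong.Add_cong lie_cong.refl lie_cong.Add_inverse)
  also have "lie_cong S R \<dots> b"
    using b by (rule lie_cong.Add_Zero)
  finally have "lie_cong S R (Add (Add b c) (Scale (-1) c)) b" .
  from lie_span.cong[OF lie_span.Add[OF bc lie_span.Scale[OF c]] lie_cong.sym[OF this]]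
  show ?thesis .
qed

section \<open>Right actions on spaces of functions\<close>

text \<open>Brackets act by \<open>\<phi>[x, y] = (\<phi>x)y - (\<phi>y)x\<close>: operators are composed from left to right.\<close>

primrec lie_act ::
    "('g \<Rightarrow> ('b \<Rightarrow> complex) \<Rightarrow> 'b \<Rightarrow> complex) \<Rightarrow> 'g lie_expr \<Rightarrow> ('b \<Rightarrow> complex) \<Rightarrow> 'b \<Rightarrow> complex" where
  "lie_act p (Gen g) f = p g f"
| "lie_act p Zero f = (\<lambda>_. 0)"
| "lie_act p (Add x y) f = (\<lambda>w. lie_act p x f w + lie_act p y f w)"
| "lie_act p (Scale c x) f = (\<lambda>w. c * lie_act p x f w)"
| "lie_act p (Bracket x y) f = (\<lambda>w. lie_act p y (lie_act p x f) w - lie_act p x (lie_act p y f) w)"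

definition linear_op :: "(('b \<Rightarrow> complex) \<Rightarrow> 'b \<Rightarrow> complex) \<Rightarrow> bool" where
  "linear_op T \<longleftrightarrow>
     (\<forall>f g. T (\<lambda>w. f w + g w) = (\<lambda>w. T f w + T g w)) \<and> (\<forall>c f. T (\<lambda>w. c * f w) = (\<lambda>w. c * T f w))"

lemma linear_op_add: "linear_op T \<Longrightarrow> T (\<lambda>w. f w + g w) = (\<lambda>w. T f w + T g w)"
  and linear_op_scale: "linear_op T \<Longrightarrow> T (\<lambda>w. c * f w) = (\<lambda>w. c * T f w)"
  by (simp_all add: linear_op_def)

lemma linear_op_zero: "linear_op T \<Longrightarrow> T (\<lambda>w. 0) = (\<lambda>w. 0)"
  using linear_op_scale[of T 0] by simp

lemma linear_op_diff:
  assumes "linear_op T"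
  shows "T (\<lambda>w. f w - g w) = (\<lambda>w. T f w - T g w)"
  using linear_op_add[OF assms, of f "\<lambda>w. (-1) * g w"] linear_op_scale[OF assms, of "-1" g] by simp

lemma linear_op_lie_act:
  assumes "\<And>g. linear_op (p g)"
  shows "linear_op (lie_act p x)"
proof (induction x)
  case (Gen g)
  then show ?case using assms[of g] by (simp add: linear_op_def)
next
  case (Bracket x y)
  then show ?case by (simp add: linear_op_def algebra_simps)
qed (simp_all add: linear_op_def algebra_simps)

text \<open>Commutators of linear operators satisfy the Lie algebra laws, so only the defining
  relations remain to be checked.\<close>

lemma lie_act_cong:
  assumes lin: "\<And>g. linear_op (p g)"
    and rel: "\<And>x y. (x, y) \<in> R \<Longrightarrow> lie_act p x = lie_act p y"
    and "lie_cong S R x y"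
  shows "lie_act p x = lie_act p y"
  using assms(3)
proof (induction rule: lie_cong.induct)
  case (relation x y)
  from relation(1) show ?case by (rule rel)
next
  case (Bracket_cong x x' y y')
  then show ?case by (intro ext) simp
qed (auto simp: fun_eq_iff algebra_simps linear_op_add linear_op_scale linear_op_diff
      linear_op_lie_act[of p, OF lin])

section \<open>Independent families\<close>

lemma lin_indep_familyD:
  assumes "lin_indep_family J K v" "\<And>k. k \<in> K \<Longrightarrow> (\<Sum>i\<in>J. c i * v i k) = 0" "i \<in> J"
  shows "c i = 0"
  using assms unfolding lin_indep_family_def by simp

text \<open>Induction by one vector, correcting a functional that is already right on
  \<open>J\<close> by one that vanishes on \<open>J\<close> but not on the new vector.\<close>

lemma lin_indep_family_dual:
  assumes "finite J" "finite K" "lin_indep_family J K v"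
  shows "\<exists>l. \<forall>i\<in>J. (\<Sum>k\<in>K. l k * v i k) = c i"
  using assms(1,3)
proof (induction J arbitrary: c rule: finite_induct)
  case empty
  then show ?case by simp
next
  case (insert j J)
  have "lin_indep_family J K v"
    unfolding lin_indep_family_def
  proof (intro allI impI)
    fix c assume z: "\<forall>k\<in>K. (\<Sum>i\<in>J. c i * v i k) = 0"
    have "(\<Sum>i\<in>insert j J. (if i = j then 0 else c i) * v i k) = (\<Sum>i\<in>J. c i * v i k)" for k
      using insert.hyps by (auto intro!: sum.cong)
    with z have *: "(\<Sum>i\<in>insert j J. (if i = j then 0 else c i) * v i k) = 0" if "k \<in> K" for k
      using that by simp
    have "(if i = j then 0 else c i) = 0" if "i \<in> J" for i
      by (rule lin_indep_familyD[OF insert.prems *]) (use that in auto)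
    moreover have "i \<noteq> j" if "i \<in> J" for i
      using that insert.hyps by blast
    ultimately show "\<forall>i\<in>J. c i = 0"
      by simp
  qed
  then have IH: "\<exists>l. \<forall>i\<in>J. (\<Sum>k\<in>K. l k * v i k) = c i" for c
    using insert.IH by blast
  have "\<forall>a. \<exists>l. \<forall>i\<in>J. (\<Sum>k\<in>K. l k * v i k) = (if i = a then 1 else 0)"
    by (intro allI IH)
  from choice[OF this] obtain D
    where D: "\<And>a i. i \<in> J \<Longrightarrow> (\<Sum>k\<in>K. D a k * v i k) = (if i = a then 1 else 0)"
    by blast
  let ?r = "\<lambda>a. \<Sum>k\<in>K. D a k * v j k"
  \<comment> \<open>Subtracting from \<open>v j\<close> its expansion along the dual functionals
    leaves a nonzero vector by independence; \<open>q\<close> is a coordinate where this remainder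
    is nonzero.\<close>
  have "\<exists>q\<in>K. v j q - (\<Sum>a\<in>J. ?r a * v a q) \<noteq> 0"
  proof (rule ccontr)
    assume "\<not> ?thesis"
    then have z: "\<And>q. q \<in> K \<Longrightarrow> v j q - (\<Sum>a\<in>J. ?r a * v a q) = 0" by blast
    have "(\<Sum>i\<in>insert j J. (if i = j then 1 else - ?r i) * v i q) = 0" if "q \<in> K" for q
    proof -
      have "(\<Sum>i\<in>insert j J. (if i = j then 1 else - ?r i) * v i q)
          = v j q + (\<Sum>i\<in>J. (if i = j then 1 else - ?r i) * v i q)"
        using insert.hyps by simp
      also have "(\<Sum>i\<in>J. (if i = j then 1 else - ?r i) * v i q) = (\<Sum>i\<in>J. - (?r i * v i q))"
        using insert.hyps by (intro sum.cong) auto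
      finally show ?thesis using z[OF that] by (simp add: sum_negf)
    qed
    from lin_indep_familyD[OF insert.prems this, of j] show False by simp
  qed
  then obtain q where q: "q \<in> K" and nz: "v j q - (\<Sum>a\<in>J. ?r a * v a q) \<noteq> 0" by blast
  \<comment> \<open>The coordinate functional at \<open>q\<close>, corrected to vanish on every
    \<open>v i\<close> with \<open>i\<close> in \<open>J\<close>; on \<open>v j\<close> its value is
    the remainder at \<open>q\<close>.\<close>
  define m where "m k = (if k = q then 1 else 0) - (\<Sum>a\<in>J. v a q * D a k)" for k
  have m: "(\<Sum>k\<in>K. m k * v i k) = v i q - (\<Sum>a\<in>J. v a q * (\<Sum>k\<in>K. D a k * v i k))" for i
  proof -
    have "(\<Sum>k\<in>K. m k * v i k)
        = (\<Sum>k\<in>K. (if k = q then v i k else 0)) - (\<Sum>k\<in>K. \<Sum>a\<in>J. v a q * (D a k * v i k))"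
      unfolding sum_subtractf[symmetric]
      by (intro sum.cong) (auto simp: m_def left_diff_distrib sum_distrib_right mult.assoc)
    also have "(\<Sum>k\<in>K. \<Sum>a\<in>J. v a q * (D a k * v i k)) = (\<Sum>a\<in>J. v a q * (\<Sum>k\<in>K. D a k * v i k))"
      by (subst sum.swap) (simp add: sum_distrib_left)
    finally show ?thesis using q assms(2) by simp
  qed
  have mJ: "(\<Sum>k\<in>K. m k * v i k) = 0" if "i \<in> J" for i
    using that insert.hyps by (simp add: m D if_distrib cong: if_cong)
  have mj: "(\<Sum>k\<in>K. m k * v j k) \<noteq> 0"
    using nz by (simp add: m mult.commute)
  obtain l where l: "\<forall>i\<in>J. (\<Sum>k\<in>K. l k * v i k) = c i" using IH by blast
  let ?t = "(c j - (\<Sum>k\<in>K. l k * v j k)) / (\<Sum>k\<in>K. m k * v j k)"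
  have lin: "(\<Sum>k\<in>K. (l k + ?t * m k) * v i k)
      = (\<Sum>k\<in>K. l k * v i k) + ?t * (\<Sum>k\<in>K. m k * v i k)" for i
    by (simp only: distrib_right sum.distrib mult.assoc flip: sum_distrib_left)
  have "\<forall>i\<in>insert j J. (\<Sum>k\<in>K. (l k + ?t * m k) * v i k) = c i"
    unfolding lin using l mJ mj by simp
  then show ?case by (intro exI)
qed

section \<open>Triangular decomposition\<close>

definition content :: "'i list \<Rightarrow> 'i \<Rightarrow> int" where
  "content u = (\<lambda>i. int (count_list u i))"

lemma content_Nil [simp]: "content [] = (\<lambda>_. 0)"
  by (simp add: content_def)

lemma content_Cons: "content (i # u) = (\<lambda>k. content u k + simple_root i k)"
  by (auto simp: content_def simple_root_def)

lemma content_append: "content (a @ b) = (\<lambda>k. content a k + content b k)"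
  by (auto simp: content_def)

lemma content_nonneg: "0 \<le> content u i"
  by (simp add: content_def)

lemma content_nonzero_iff: "content u i \<noteq> 0 \<longleftrightarrow> i \<in> set u"
  by (simp add: content_def count_list_0_iff)

text \<open>\<open>True\<close> selects the generators \<open>E i\<close> and \<open>False\<close> the generators \<open>F i\<close>, so that the two
  triangular halves are treated simultaneously.\<close>

definition root_gen :: "bool \<Rightarrow> 'i \<Rightarrow> 'i km_gen lie_expr" where
  "root_gen s i = Gen (if s then E i else F i)"

definition sg :: "bool \<Rightarrow> complex" where
  "sg s = (if s then 1 else -1)"

text \<open>Right-normed brackets: \<open>span_tri\<close> shows that together with the Cartan
  subalgebra they span everything, and peeling off the outer letter permits induction on the
  word.\<close>

fun nest :: "bool \<Rightarrow> 'i list \<Rightarrow> 'i km_gen lie_expr" where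
  "nest s [] = Zero"
| "nest s [i] = root_gen s i"
| "nest s (i # j # u) = Bracket (root_gen s i) (nest s (j # u))"

lemma nest_Cons: "u \<noteq> [] \<Longrightarrow> nest s (i # u) = Bracket (root_gen s i) (nest s u)"
  by (cases u) auto

locale km_presentation =
  fixes A :: "'i \<Rightarrow> 'i \<Rightarrow> int" and I :: "'i set" and \<rho> :: "'i realization"
  assumes fin: "finite I" and realization: "is_realization A I \<rho>"
begin

abbreviation "gs \<equiv> km_gens I \<rho>"
abbreviation "rels \<equiv> km_relations I \<rho>"
abbreviation eqv (infix "\<approx>" 50) where "x \<approx> y \<equiv> lie_cong gs rels x y"
abbreviation "exprs \<equiv> lie_exprs gs"
abbreviation "lspan \<equiv> lie_span gs rels"
abbreviation "coroot \<equiv> simple_coroot \<rho>"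
abbreviation "ev \<equiv> root_eval I \<rho>"

lemma root_eval_add: "ev (\<lambda>k. \<alpha> k + \<beta> k) h = ev \<alpha> h + ev \<beta> h"
  and root_eval_diff: "ev (\<lambda>k. \<alpha> k - \<beta> k) h = ev \<alpha> h - ev \<beta> h"
  and root_eval_uminus: "ev (\<lambda>k. - \<alpha> k) h = - ev \<alpha> h"
  by (simp_all add: root_eval_def algebra_simps sum.distrib sum_subtractf sum_negf)

lemma root_eval_0 [simp]: "ev (\<lambda>_. 0) h = 0"
  by (simp add: root_eval_def)

lemma root_eval_simple: "i \<in> I \<Longrightarrow> ev (simple_root i) h = pairing \<rho> i h"
proof -
  assume i: "i \<in> I"
  have "ev (simple_root i) h = (\<Sum>k\<in>I. if k = i then pairing \<rho> k h else 0)"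
    unfolding root_eval_def by (intro sum.cong) (auto simp: simple_root_def)
  then show ?thesis using i fin by simp
qed

lemma coroot_cartan: "i \<in> I \<Longrightarrow> coroot i \<in> cartan \<rho>"
  using realization by (simp add: is_realization_def)

lemma root_gen_exprs [simp]: "i \<in> I \<Longrightarrow> root_gen s i \<in> exprs"
  by (simp add: root_gen_def km_gens_def)

lemma H_exprs [simp]: "h \<in> cartan \<rho> \<Longrightarrow> Gen (H h) \<in> exprs"
  by (simp add: km_gens_def)

lemma H_gens [simp]: "h \<in> cartan \<rho> \<Longrightarrow> H h \<in> gs"
  by (simp add: km_gens_def)

lemma nest_exprs [simp]: "u \<in> lists I \<Longrightarrow> nest s u \<in> exprs"
  by (induction s u rule: nest.induct) auto

lemma cartan_add [simp]: "h \<in> cartan \<rho> \<Longrightarrow> h' \<in> cartan \<rho> \<Longrightarrow> (\<lambda>k. h k + h' k) \<in> cartan \<rho>"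
  and cartan_scale [simp]: "h \<in> cartan \<rho> \<Longrightarrow> (\<lambda>k. c * h k) \<in> cartan \<rho>"
  and cartan_0 [simp]: "(\<lambda>k. 0) \<in> cartan \<rho>"
  by (simp_all add: cartan_def)

lemma H_add: "h \<in> cartan \<rho> \<Longrightarrow> h' \<in> cartan \<rho> \<Longrightarrow>
    Add (Gen (H h)) (Gen (H h')) \<approx> Gen (H (\<lambda>k. h k + h' k))"
  by (rule lie_cong.relation) (auto simp: km_relations_def intro: cartan_add)

lemma H_scale: "h \<in> cartan \<rho> \<Longrightarrow> Scale c (Gen (H h)) \<approx> Gen (H (\<lambda>k. c * h k))"
  by (rule lie_cong.relation) (auto simp: km_relations_def intro: cartan_scale)

lemma H_0: "Gen (H (\<lambda>k. 0)) \<approx> Zero"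
proof -
  have "Gen (H (\<lambda>k. 0)) \<approx> Scale 0 (Gen (H (\<lambda>k. 0)))"
    using H_scale[OF cartan_0, of 0] by (simp add: lie_cong.sym)
  also have "\<dots> \<approx> Zero" by (rule Scale_0) (simp add: cartan_0)
  finally show ?thesis .
qed

lemma H_H: "h \<in> cartan \<rho> \<Longrightarrow> h' \<in> cartan \<rho> \<Longrightarrow> Bracket (Gen (H h)) (Gen (H h')) \<approx> Zero"
  by (rule lie_cong.relation) (auto simp: km_relations_def)

lemma H_root_gen:
  assumes "h \<in> cartan \<rho>" "i \<in> I"
  shows "Bracket (Gen (H h)) (root_gen s i) \<approx> Scale (sg s * pairing \<rho> i h) (root_gen s i)"
proof (rule lie_cong.relation)
  show "(Bracket (Gen (H h)) (root_gen s i), Scale (sg s * pairing \<rho> i h) (root_gen s i)) \<in> rels"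
    using assms unfolding km_relations_def root_gen_def sg_def by (cases s) auto
qed (use assms in auto)

lemma root_gen_opposite:
  assumes i: "i \<in> I" and j: "j \<in> I"
  shows "Bracket (root_gen s i) (root_gen (\<not> s) j) \<approx>
    (if i = j then Scale (sg s) (Gen (H (coroot i))) else Zero)"
proof -
  have *: "Bracket (root_gen True i) (root_gen False j) \<approx>
      (if i = j then Gen (H (coroot i)) else Zero)" if "i \<in> I" "j \<in> I" for i j
  proof (rule lie_cong.relation)
    show "(Bracket (root_gen True i) (root_gen False j),
        if i = j then Gen (H (coroot i)) else Zero) \<in> rels"
      using that unfolding km_relations_def root_gen_def by auto
  qed (use that coroot_cartan in auto)
  show ?thesis
  proof (cases s)
    case True
    have "Gen (H (coroot i)) \<approx> Scale 1 (Gen (H (coroot i)))"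
      using i by (intro lie_cong.sym[OF lie_cong.Scale_one]) (simp add: coroot_cartan)
    then show ?thesis
      using *[OF i j] True by (auto simp: sg_def intro: lie_cong.trans)
  next
    case False
    have "Bracket (root_gen False i) (root_gen True j) \<approx>
        Scale (-1) (Bracket (root_gen True j) (root_gen False i))"
      using i j by (intro Bracket_antisym) auto
    also have "\<dots> \<approx> Scale (-1) (if j = i then Gen (H (coroot j)) else Zero)"
      by (intro lie_cong.Scale_cong * i j)
    also have "\<dots> \<approx> (if i = j then Scale (-1) (Gen (H (coroot i))) else Zero)"
      using i by (auto intro!: Scale_Zero lie_cong.refl simp: coroot_cartan)
    finally show ?thesis using False by (cases "i = j") (simp_all add: sg_def)
  qed
qed

lemma H_nest:
  assumes h: "h \<in> cartan \<rho>" and "u \<in> lists I"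
  shows "Bracket (Gen (H h)) (nest s u) \<approx> Scale (sg s * ev (content u) h) (nest s u)"
  using assms(2)
proof (induction s u rule: nest.induct)
  case (1 s)
  have "Bracket (Gen (H h)) Zero \<approx> Zero"
    using h by (intro Bracket_Zero) simp
  then show ?case
    by (auto intro: lie_cong.trans lie_cong.sym[OF Scale_Zero])
next
  case (2 s i)
  then show ?case
    using H_root_gen[OF h, of i s] by (simp add: content_Cons root_eval_simple)
next
  case (3 s i j u)
  have "Bracket (Gen (H h)) (nest s (i # j # u)) \<approx>
      Scale (sg s * pairing \<rho> i h + sg s * ev (content (j # u)) h) (nest s (i # j # u))"
    unfolding nest.simps using 3 h by (intro weight_Bracket H_root_gen 3) auto
  then show ?case
    using 3 by (simp add: content_Cons[of i] root_eval_add root_eval_simple algebra_simps)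
qed

definition H_set :: "'i km_gen lie_expr set" where
  "H_set = {Gen (H h) |h. h \<in> cartan \<rho>}"

definition nests :: "bool \<Rightarrow> nat \<Rightarrow> 'i km_gen lie_expr set" where
  "nests s n = {nest s u |u. u \<in> lists I \<and> length u = n}"

lemma nestsI: "u \<in> lists I \<Longrightarrow> nest s u \<in> nests s (length u)"
  by (auto simp: nests_def)

lemma span_nest: "u \<in> lists I \<Longrightarrow> length u = n \<Longrightarrow> lspan (nests s n) (nest s u)"
  using nestsI nest_exprs by (metis lie_span.base)

lemma span_H: "h \<in> cartan \<rho> \<Longrightarrow> lspan H_set (Gen (H h))"
  by (auto intro!: lie_span.base simp: H_set_def)

lemma span_root_gen_opposite:
  assumes "i \<in> I" "j \<in> I"
  shows "lspan H_set (Bracket (root_gen (\<not> s) i) (root_gen s j))"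
proof (rule lie_span.cong)
  show "Bracket (root_gen (\<not> s) i) (root_gen s j) \<approx>
      (if i = j then Scale (sg (\<not> s)) (Gen (H (coroot i))) else Zero)"
    using root_gen_opposite[OF assms, of "\<not> s"] by simp
qed (use assms in \<open>auto intro: lie_span.Zero lie_span.Scale span_H coroot_cartan\<close>)

lemma span_root_gen_nest:
  assumes "i \<in> I" "n > 0" "lspan (nests s n) x"
  shows "lspan (nests s (Suc n)) (Bracket (root_gen s i) x)"
proof (rule lie_span_Bracket_right[OF _ _ assms(3)])
  fix b assume "b \<in> nests s n"
  then obtain v where v: "v \<in> lists I" "length v = n" "b = nest s v" by (auto simp: nests_def)
  then have "Bracket (root_gen s i) b = nest s (i # v)"
    using assms(2) by (cases v) auto
  then show "lspan (nests s (Suc n)) (Bracket (root_gen s i) b)"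
    using v assms(1) span_nest[of "i # v" "Suc n" s] by simp
qed (use assms in auto)

lemma span_root_gen_H:
  assumes "i \<in> I" "lspan H_set x"
  shows "lspan (nests s 1) (Bracket (root_gen s i) x)"
proof (rule lie_span_Bracket_right[OF _ _ assms(2)])
  fix b assume "b \<in> H_set"
  then obtain h where h: "h \<in> cartan \<rho>" "b = Gen (H h)" by (auto simp: H_set_def)
  have "lspan (nests s 1) (Bracket b (root_gen s i))"
    using lie_span.cong[OF lie_span.Scale H_root_gen[OF h(1) assms(1), of s]]
      span_nest[of "[i]" 1 s] assms(1) h by simp
  then show "lspan (nests s 1) (Bracket (root_gen s i) b)"
    using h assms(1) by (intro lie_span_Bracket_swap[of b]) auto
qed (use assms in auto)

lemma span_H_nest:
  assumes "u \<in> lists I" "length u = n" "lspan H_set x"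
  shows "lspan (nests s n) (Bracket x (nest s u))"
proof (rule lie_span_Bracket_left[OF _ _ assms(3)])
  fix b assume "b \<in> H_set"
  then obtain h where h: "h \<in> cartan \<rho>" "b = Gen (H h)" by (auto simp: H_set_def)
  then show "lspan (nests s n) (Bracket b (nest s u))"
    using lie_span.cong[OF lie_span.Scale[OF span_nest[OF assms(1,2)]] H_nest[OF h(1) assms(1), of s]]
    by simp
qed (use assms in auto)

text \<open>The Leibniz rule splits the bracket in two: a Cartan element acting on the inner nest by
  a scalar, and a term for the induction hypothesis. Length at least two keeps the result in the
  same half; for a single letter it would be a Cartan element.\<close>

lemma span_opposite_nest:
  assumes j: "j \<in> I" and "u \<in> lists I" "length u = Suc n" "n > 0"
  shows "lspan (nests s n) (Bracket (root_gen (\<not> s) j) (nest s u))"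
  using assms(2-)
proof (induction u arbitrary: n rule: list.induct)
  case Nil
  then show ?case by simp
next
  case (Cons i u)
  then have u: "u \<in> lists I" "length u = n" "u \<noteq> []" and i: "i \<in> I" by auto
  let ?g = "root_gen (\<not> s) j"
  have "Bracket ?g (nest s (i # u)) \<approx>
      Add (Bracket (Bracket ?g (root_gen s i)) (nest s u)) (Bracket (root_gen s i) (Bracket ?g (nest s u)))"
    unfolding nest_Cons[OF u(3)] using u i j by (intro Jacobi_Leibniz) auto
  moreover have 1: "lspan (nests s n) (Bracket (Bracket ?g (root_gen s i)) (nest s u))"
    using u by (intro span_H_nest span_root_gen_opposite i j)
  moreover have 2: "lspan (nests s n) (Bracket (root_gen s i) (Bracket ?g (nest s u)))"
  \<comment> \<open>A one-letter \<open>u\<close> is outside the induction hypothesis: its bracket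
    with \<open>?g\<close> is a Cartan element, and the outer letter brings it back to length
    one.\<close>
  proof (cases "n = 1")
    case True
    then obtain k where k: "u = [k]" using u(2) by (cases u) auto
    then have "lspan H_set (Bracket ?g (nest s u))"
      using u j span_root_gen_opposite by auto
    then show ?thesis
      using span_root_gen_H[OF i] True by simp
  next
    case False
    then obtain m where m: "n = Suc m" "m > 0" using Cons.prems(3) by (cases n) auto
    then show ?thesis
      using span_root_gen_nest[OF i, of m] Cons.IH[of m] u by simp
  qed
  ultimately show ?case
    using lie_span.cong[OF lie_span.Add[OF 1 2]] by blast
qed

definition tri_set :: "'i km_gen lie_expr set" where
  "tri_set = H_set \<union> (\<Union>s n. nests s n)"

lemma span_nests_tri: "lspan (nests s n) x \<Longrightarrow> lspan tri_set x"
  by (erule lie_span_mono) (auto simp: tri_set_def)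

lemma span_H_tri: "lspan H_set x \<Longrightarrow> lspan tri_set x"
  by (erule lie_span_mono) (auto simp: tri_set_def)

lemma km_gens_cases:
  assumes "g \<in> gs"
  obtains (root) s i where "i \<in> I" "Gen g = root_gen s i" | (H) h where "h \<in> cartan \<rho>" "g = H h"
proof -
  have "Gen (E i) = root_gen True i" "Gen (F i) = root_gen False i" for i :: 'i
    by (simp_all add: root_gen_def)
  then show ?thesis using assms that unfolding km_gens_def by blast
qed

lemma span_tri_Gen_Bracket:
  assumes g: "g \<in> gs" and x: "lspan tri_set x"
  shows "lspan tri_set (Bracket (Gen g) x)"
proof (rule lie_span_Bracket_right[OF _ _ x])
  fix b assume "b \<in> tri_set"
  then consider h where "h \<in> cartan \<rho>" "b = Gen (H h)"
    | s u where "u \<in> lists I" "b = nest s u"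
    by (auto simp: tri_set_def H_set_def nests_def)
  then show "lspan tri_set (Bracket (Gen g) b)"
  proof cases
    case (1 h)
    from g show ?thesis
    proof (cases rule: km_gens_cases)
      case (root s i)
      then show ?thesis
        using 1 span_nests_tri[OF span_root_gen_H[OF root(1) span_H[OF 1(1)]]] by simp
    next
      case (H h')
      then show ?thesis using 1 lie_span.cong[OF lie_span.Zero H_H] by simp
    qed
  next
    case (2 s u)
    show ?thesis
    proof (cases "u = []")
      case True
      then show ?thesis
        using 2 g lie_span.cong[OF lie_span.Zero Bracket_Zero[of "Gen g"]] by simp
    next
      case ne: False
      from g show ?thesis
      proof (cases rule: km_gens_cases)
        case (H h)
        show ?thesis
          unfolding H 2 by (intro span_nests_tri[OF span_H_nest[OF 2(1) HOL.refl span_H[OF H(1)]]])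
      next
        case (root s' i)
        consider (same) "s' = s" | (short) "s' = (\<not> s)" "\<exists>k. u = [k]"
          | (long) "s' = (\<not> s)" "length u > 1"
          \<comment> \<open>\<open>remdups_adj.cases\<close> serves only as the split into empty,
            one-letter and longer words.\<close>
          using ne by (cases s; cases s'; cases u rule: remdups_adj.cases) auto
        then show ?thesis
        proof cases
          case same
          then show ?thesis
            using span_nests_tri[OF span_root_gen_nest[OF root(1) _ span_nest[OF 2(1) HOL.refl, of s]]]
              root 2 ne by simp
        next
          case short
          then obtain k where k: "u = [k]" by blast
          then show ?thesis
            using 2 root short span_H_tri[OF span_root_gen_opposite[OF root(1), of k s]] by simp
        next
          case long
          then obtain m where "length u = Suc m" "m > 0" by (cases u) auto
          then show ?thesis
            using span_nests_tri[OF span_opposite_nest[OF root(1) 2(1), of m s]] root 2 long by simp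
        qed
      qed
    qed
  qed
qed (use g in simp)

text \<open>Elements whose adjoint action preserves the span form a subalgebra, and
  \<open>span_tri_Gen_Bracket\<close> puts the generators in it. In the \<open>Bracket\<close> case
  the Leibniz rule yields the wanted term plus one already in the span, which is cancelled.\<close>

lemma span_tri_Bracket:
  assumes "y \<in> exprs" "lspan tri_set x"
  shows "lspan tri_set (Bracket y x)"
  using assms
proof (induction y arbitrary: x)
  case (Gen g)
  then show ?case by (simp add: span_tri_Gen_Bracket)
next
  case Zero
  note x = lie_span_exprs[OF Zero(2)]
  show ?case
    by (rule lie_span_Bracket_swap[OF x _ lie_span.cong[OF lie_span.Zero Bracket_Zero[OF x]]]) simp
next
  case (Add y z)
  show ?case
    by (rule lie_span.cong[OF lie_span.Add lie_cong.Bracket_Add_left])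
      (use Add in \<open>auto dest: lie_span_exprs\<close>)
next
  case (Scale c y)
  show ?case
    by (rule lie_span.cong[OF lie_span.Scale lie_cong.Bracket_Scale_left])
      (use Scale in \<open>auto dest: lie_span_exprs\<close>)
next
  case (Bracket y z)
  then have yz: "y \<in> exprs" "z \<in> exprs" and x: "x \<in> exprs" by (auto dest: lie_span_exprs)
  have "lspan tri_set (Bracket y (Bracket z x))"
    using Bracket yz by blast
  moreover have "Bracket y (Bracket z x) \<approx> Add (Bracket (Bracket y z) x) (Bracket z (Bracket y x))"
    using yz x by (intro Jacobi_Leibniz)
  ultimately have "lspan tri_set (Add (Bracket (Bracket y z) x) (Bracket z (Bracket y x)))"
    by (rule lie_span.cong[OF _ lie_cong.sym])
  moreover have "lspan tri_set (Bracket z (Bracket y x))"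
    using Bracket yz by blast
  ultimately show ?case by (rule lie_span_Add_cancel)
qed

lemma span_tri: "x \<in> exprs \<Longrightarrow> lspan tri_set x"
proof (induction x)
  case (Gen g)
  then have "g \<in> gs" by simp
  then show ?case
  proof (cases rule: km_gens_cases)
    case (root s i)
    then show ?thesis using span_nests_tri[OF span_nest[of "[i]" 1 s]] by simp
  next
    case (H h)
    then show ?thesis using span_H_tri[OF span_H] by simp
  qed
next
  case (Bracket y z)
  then show ?case by (simp add: span_tri_Bracket)
qed (auto intro: lie_span.intros)

end

section \<open>Extraction of the degree zero part\<close>

text \<open>\<open>weight_filter e n\<close> applies \<open>\<Prod>\<^sub>j\<^sub>\<le>\<^sub>n (D\<^sup>2 - j\<^sup>2)\<close> with \<open>D = ad e\<close>.  It annihilates the eigenvectors of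
  \<open>D\<close> with eigenvalues \<open>\<plusminus>1, \<dots>, \<plusminus>n\<close> and rescales its kernel.\<close>

primrec weight_filter :: "'g lie_expr \<Rightarrow> nat \<Rightarrow> 'g lie_expr \<Rightarrow> 'g lie_expr" where
  "weight_filter e 0 x = x"
| "weight_filter e (Suc n) x =
     Add (Bracket e (Bracket e (weight_filter e n x)))
       (Scale (- (of_nat (Suc n))\<^sup>2) (weight_filter e n x))"

text \<open>Eigenvalue of \<open>weight_filter e n\<close> on an eigenvector of \<open>ad e\<close>
  with eigenvalue \<open>a\<close>. Only the square of \<open>a\<close> enters, so raising and
  lowering brackets are removed together.\<close>

definition filter_coeff :: "complex \<Rightarrow> nat \<Rightarrow> complex" where
  "filter_coeff a n = (\<Prod>j\<in>{1..n}. a\<^sup>2 - (of_nat j)\<^sup>2)"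

lemma filter_coeff_eq_0: "1 \<le> j \<Longrightarrow> j \<le> n \<Longrightarrow> a\<^sup>2 = (of_nat j)\<^sup>2 \<Longrightarrow> filter_coeff a n = 0"
  unfolding filter_coeff_def by (rule prod_zero) auto

lemma filter_coeff_0_nonzero: "filter_coeff 0 n \<noteq> 0"
  by (simp add: filter_coeff_def)

context
  fixes S :: "'g set" and R :: "('g lie_expr \<times> 'g lie_expr) set" and e :: "'g lie_expr"
  assumes e: "e \<in> lie_exprs S"
begin

lemma weight_filter_cong:
  "lie_cong S R x y \<Longrightarrow> lie_cong S R (weight_filter e n x) (weight_filter e n y)"
  by (induction n) (auto intro!: lie_cong.Add_cong lie_cong.Scale_cong lie_cong.Bracket_cong
      lie_cong.refl e)

lemma weight_filter_exprs: "x \<in> lie_exprs S \<Longrightarrow> weight_filter e n x \<in> lie_exprs S"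
  by (induction n) (auto simp: e)

lemma weight_filter_Scale:
  assumes x: "x \<in> lie_exprs S"
  shows "lie_cong S R (weight_filter e n (Scale c x)) (Scale c (weight_filter e n x))"
proof (induction n)
  case 0
  show ?case using x by (auto intro: lie_cong.refl)
next
  case (Suc n)
  let ?y = "weight_filter e n x" and ?c = "- (of_nat (Suc n))\<^sup>2 :: complex"
  note y = weight_filter_exprs[OF x, of n]
  have "lie_cong S R (Bracket e (Bracket e (weight_filter e n (Scale c x)))) (Bracket e (Bracket e (Scale c ?y)))"
    by (intro lie_cong.Bracket_cong lie_cong.refl e Suc)
  also have "lie_cong S R \<dots> (Bracket e (Scale c (Bracket e ?y)))"
    using y by (intro lie_cong.Bracket_cong lie_cong.refl lie_cong.Bracket_Scale_right e)
  also have "lie_cong S R \<dots> (Scale c (Bracket e (Bracket e ?y)))"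
    using y e by (intro lie_cong.Bracket_Scale_right) auto
  finally have 1: "lie_cong S R (Bracket e (Bracket e (weight_filter e n (Scale c x))))
      (Scale c (Bracket e (Bracket e ?y)))" .
  have "lie_cong S R (Scale ?c (weight_filter e n (Scale c x))) (Scale ?c (Scale c ?y))"
    by (intro lie_cong.Scale_cong Suc)
  also have "lie_cong S R \<dots> (Scale (?c * c) ?y)"
    using y by (rule lie_cong.Scale_Scale)
  also have "lie_cong S R (Scale (?c * c) ?y) (Scale c (Scale ?c ?y))"
    using lie_cong.sym[OF lie_cong.Scale_Scale[OF y, of R c ?c]] by (simp only: mult.commute)
  finally have "lie_cong S R (Scale ?c (weight_filter e n (Scale c x))) (Scale c (Scale ?c ?y))" .
  with 1 have "lie_cong S R (weight_filter e (Suc n) (Scale c x))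
      (Add (Scale c (Bracket e (Bracket e ?y))) (Scale c (Scale ?c ?y)))"
    unfolding weight_filter.simps by (intro lie_cong.Add_cong)
  also have "lie_cong S R \<dots> (Scale c (weight_filter e (Suc n) x))"
    unfolding weight_filter.simps using y e by (intro lie_cong.sym[OF lie_cong.Scale_Add]) auto
  finally show ?case .
qed

lemma Add_interchange:
  assumes "a \<in> lie_exprs S" "b \<in> lie_exprs S" "c \<in> lie_exprs S" "d \<in> lie_exprs S"
  shows "lie_cong S R (Add (Add a b) (Add c d)) (Add (Add a c) (Add b d))"
proof -
  have "lie_cong S R (Add (Add a b) (Add c d)) (Add a (Add b (Add c d)))"
    using assms by (intro lie_cong.Add_assoc) auto
  also have "lie_cong S R \<dots> (Add a (Add (Add b c) d))"
    using assms by (intro lie_cong.Add_cong lie_cong.refl lie_cong.sym[OF lie_cong.Add_assoc]) auto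
  also have "lie_cong S R \<dots> (Add a (Add (Add c b) d))"
    using assms by (intro lie_cong.Add_cong lie_cong.refl lie_cong.Add_comm) auto
  also have "lie_cong S R \<dots> (Add a (Add c (Add b d)))"
    using assms by (intro lie_cong.Add_cong lie_cong.refl lie_cong.Add_assoc) auto
  also have "lie_cong S R \<dots> (Add (Add a c) (Add b d))"
    using assms by (intro lie_cong.sym[OF lie_cong.Add_assoc]) auto
  finally show ?thesis .
qed

lemma weight_filter_Add:
  assumes x: "x \<in> lie_exprs S" and x': "x' \<in> lie_exprs S"
  shows "lie_cong S R (weight_filter e n (Add x x')) (Add (weight_filter e n x) (weight_filter e n x'))"
proof (induction n)
  case 0
  show ?case using x x' by (auto intro: lie_cong.refl)
next
  case (Suc n)
  let ?y = "weight_filter e n x" and ?y' = "weight_filter e n x'"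
  let ?c = "- (of_nat (Suc n))\<^sup>2 :: complex" and ?z = "weight_filter e n (Add x x')"
  note y = weight_filter_exprs[OF x, of n] and y' = weight_filter_exprs[OF x', of n]
  have "lie_cong S R (Bracket e (Bracket e ?z)) (Bracket e (Bracket e (Add ?y ?y')))"
    by (intro lie_cong.Bracket_cong lie_cong.refl e Suc)
  also have "lie_cong S R \<dots> (Bracket e (Add (Bracket e ?y) (Bracket e ?y')))"
    using y y' by (intro lie_cong.Bracket_cong lie_cong.refl lie_cong.Bracket_Add_right e)
  also have "lie_cong S R \<dots> (Add (Bracket e (Bracket e ?y)) (Bracket e (Bracket e ?y')))"
    using y y' e by (intro lie_cong.Bracket_Add_right) auto
  finally have 1: "lie_cong S R (Bracket e (Bracket e ?z))
      (Add (Bracket e (Bracket e ?y)) (Bracket e (Bracket e ?y')))" .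
  have "lie_cong S R (Scale ?c ?z) (Scale ?c (Add ?y ?y'))"
    by (intro lie_cong.Scale_cong Suc)
  also have "lie_cong S R \<dots> (Add (Scale ?c ?y) (Scale ?c ?y'))"
    using y y' by (rule lie_cong.Scale_Add)
  finally have "lie_cong S R (Scale ?c ?z) (Add (Scale ?c ?y) (Scale ?c ?y'))" .
  with 1 have "lie_cong S R (weight_filter e (Suc n) (Add x x'))
      (Add (Add (Bracket e (Bracket e ?y)) (Bracket e (Bracket e ?y')))
        (Add (Scale ?c ?y) (Scale ?c ?y')))"
    unfolding weight_filter.simps by (intro lie_cong.Add_cong)
  also have "lie_cong S R \<dots> (Add (weight_filter e (Suc n) x) (weight_filter e (Suc n) x'))"
    unfolding weight_filter.simps using y y' e by (intro Add_interchange) auto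
  finally show ?case .
qed

lemma weight_filter_eigenvector:
  assumes x: "lie_cong S R (Bracket e x) (Scale a x)"
  shows "lie_cong S R (weight_filter e n x) (Scale (filter_coeff a n) x)"
proof (induction n)
  case 0
  show ?case
    using lie_cong_exprs[OF x] by (auto simp: filter_coeff_def intro: lie_cong.sym[OF lie_cong.Scale_one])
next
  case (Suc n)
  let ?z = "weight_filter e n x" and ?p = "filter_coeff a n"
  let ?c = "- (of_nat (Suc n))\<^sup>2 :: complex"
  have x': "x \<in> lie_exprs S" using lie_cong_exprs[OF x] by auto
  have step: "lie_cong S R (Bracket e (Scale b x)) (Scale (b * a) x)" for b
  proof -
    have "lie_cong S R (Bracket e (Scale b x)) (Scale b (Bracket e x))"
      using e x' by (rule lie_cong.Bracket_Scale_right)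
    also have "lie_cong S R \<dots> (Scale b (Scale a x))"
      by (intro lie_cong.Scale_cong x)
    also have "lie_cong S R \<dots> (Scale (b * a) x)"
      using x' by (rule lie_cong.Scale_Scale)
    finally show ?thesis .
  qed
  have "lie_cong S R (Bracket e (Bracket e ?z)) (Bracket e (Bracket e (Scale ?p x)))"
    by (intro lie_cong.Bracket_cong lie_cong.refl e Suc)
  also have "lie_cong S R \<dots> (Bracket e (Scale (?p * a) x))"
    by (intro lie_cong.Bracket_cong lie_cong.refl e step)
  also have "lie_cong S R \<dots> (Scale (?p * a * a) x)"
    by (rule step)
  finally have 1: "lie_cong S R (Bracket e (Bracket e ?z)) (Scale (?p * a * a) x)" .
  have "lie_cong S R (Scale ?c ?z) (Scale ?c (Scale ?p x))"
    by (intro lie_cong.Scale_cong Suc)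
  also have "lie_cong S R \<dots> (Scale (?c * ?p) x)"
    using x' by (rule lie_cong.Scale_Scale)
  finally have "lie_cong S R (Scale ?c ?z) (Scale (?c * ?p) x)" .
  with 1 have "lie_cong S R (weight_filter e (Suc n) x) (Add (Scale (?p * a * a) x) (Scale (?c * ?p) x))"
    unfolding weight_filter.simps by (intro lie_cong.Add_cong)
  also have "lie_cong S R \<dots> (Scale (?p * a * a + ?c * ?p) x)"
    using x' by (rule lie_cong.sym[OF lie_cong.Scale_plus])
  also have "?p * a * a + ?c * ?p = filter_coeff a (Suc n)"
    by (simp add: filter_coeff_def algebra_simps power2_eq_square)
  finally show ?case .
qed

lemma weight_filter_ideal:
  assumes "lie_ideal S R J" "x \<in> J"
  shows "weight_filter e n x \<in> J"
  using assms by (induction n) (auto simp: lie_ideal_def e)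

end

context km_presentation
begin

section \<open>Cartan elements and highest weights with prescribed values\<close>

lemma pairing_dual:
  obtains h where "h \<in> cartan \<rho>" "\<And>i. i \<in> I \<Longrightarrow> pairing \<rho> i h = c i"
proof -
  let ?m = "cartan_dim \<rho>"
  have "lin_indep_family I {..<?m} (simple_form \<rho>)"
    using realization by (simp add: is_realization_def)
  from lin_indep_family_dual[OF fin _ this, of c] obtain l
    where l: "\<forall>i\<in>I. (\<Sum>k<?m. l k * simple_form \<rho> i k) = c i" by auto
  let ?h = "\<lambda>k. if k < ?m then l k else 0"
  have "pairing \<rho> i ?h = c i" if "i \<in> I" for i
  proof -
    have "pairing \<rho> i ?h = (\<Sum>k<?m. l k * simple_form \<rho> i k)"
      unfolding pairing_def by (intro sum.cong) auto
    then show ?thesis using l that by simp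
  qed
  moreover have "?h \<in> cartan \<rho>" by (simp add: cartan_def)
  ultimately show ?thesis using that by blast
qed

text \<open>This is what allows a highest weight for one realization to be matched by one for
  another.\<close>

lemma coroot_dual:
  obtains lam :: "nat \<Rightarrow> complex"
  where "\<And>i. i \<in> I \<Longrightarrow> (\<Sum>k<cartan_dim \<rho>. lam k * coroot i k) = c i"
proof -
  have "lin_indep_family I {..<cartan_dim \<rho>} coroot"
    using realization by (simp add: is_realization_def)
  from lin_indep_family_dual[OF fin _ this, of c] show ?thesis using that by auto
qed

lemma root_eval_inj:
  assumes eq: "\<And>h. h \<in> cartan \<rho> \<Longrightarrow> ev \<alpha> h = ev \<beta> h" and i: "i \<in> I"
  shows "\<alpha> i = \<beta> i"
proof -
  obtain h where h: "h \<in> cartan \<rho>" "\<And>k. k \<in> I \<Longrightarrow> pairing \<rho> k h = (if k = i then 1 else 0)"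
    using pairing_dual[of "\<lambda>k. if k = i then 1 else 0"] by blast
  have "ev \<gamma> h = of_int (\<gamma> i)" for \<gamma>
  proof -
    have "ev \<gamma> h = (\<Sum>k\<in>I. if k = i then of_int (\<gamma> k) else 0)"
      unfolding root_eval_def by (intro sum.cong) (auto simp: h)
    then show ?thesis using i fin by simp
  qed
  then show ?thesis using eq[OF h(1)] by simp
qed

lemma sum_content: "u \<in> lists I \<Longrightarrow> (\<Sum>i\<in>I. content u i) = int (length u)"
proof (induction u)
  case (Cons i u)
  have "(\<Sum>k\<in>I. simple_root i k) = 1"
    unfolding simple_root_def using Cons fin by simp
  then show ?case using Cons by (simp add: content_Cons sum.distrib)
qed simp

text \<open>The principal grading: \<open>ad grading\<close> multiplies a nest of \<open>n\<close>
  raising letters by \<open>n\<close> and one of \<open>n\<close> lowering letters by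
  \<open>-n\<close>, integers that the filter can remove.\<close>

definition grading :: "nat \<Rightarrow> complex" where
  "grading = (SOME h. h \<in> cartan \<rho> \<and> (\<forall>i\<in>I. pairing \<rho> i h = 1))"

lemma grading: "grading \<in> cartan \<rho>" "i \<in> I \<Longrightarrow> pairing \<rho> i grading = 1"
proof -
  have "\<exists>h. h \<in> cartan \<rho> \<and> (\<forall>i\<in>I. pairing \<rho> i h = 1)"
    using pairing_dual[of "\<lambda>_. 1"] by metis
  from someI_ex[OF this] show "grading \<in> cartan \<rho>" "i \<in> I \<Longrightarrow> pairing \<rho> i grading = 1"
    unfolding grading_def by auto
qed

lemma root_eval_grading: "ev \<alpha> grading = of_int (\<Sum>i\<in>I. \<alpha> i)"
  unfolding root_eval_def by (simp add: grading)

text \<open>The element \<open>h\<close> is the degree zero component of \<open>x\<close>. It is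
  fixed before \<open>n\<close>, and the claim is for all large \<open>n\<close>, so that in the sum
  case one \<open>n\<close> serves both summands.\<close>

lemma weight_filter_zero_part:
  assumes "lspan tri_set x"
  shows "\<exists>h\<in>cartan \<rho>. \<exists>N. \<forall>n\<ge>N.
    weight_filter (Gen (H grading)) n x \<approx> Scale (filter_coeff 0 n) (Gen (H h))"
  using assms
proof (induction rule: lie_span.induct)
  let ?e = "Gen (H grading)"
  have e: "?e \<in> exprs" using grading by simp
  have Z: "Zero \<approx> Scale c (Gen (H (\<lambda>_. 0)))" for c
    by (rule lie_cong.sym[OF Scale_cong_Zero[OF H_0]])
  {
    case (base x)
    then consider h where "h \<in> cartan \<rho>" "x = Gen (H h)" | s u where "u \<in> lists I" "x = nest s u"
      by (auto simp: tri_set_def H_set_def nests_def)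
    then show ?case
    proof cases
      case (1 h)
      have "Bracket ?e x \<approx> Zero" unfolding 1 by (intro H_H grading 1)
      also have "Zero \<approx> Scale 0 x" by (rule lie_cong.sym[OF Scale_0[OF base(2)]])
      finally show ?thesis
        using weight_filter_eigenvector[OF e] 1 by blast
    next
      case (2 s u)
      have "weight_filter ?e n x \<approx> Scale (filter_coeff 0 n) (Gen (H (\<lambda>_. 0)))"
        if n: "length u \<le> n" for n
      proof -
        have w: "weight_filter ?e n x \<approx> Scale (filter_coeff (sg s * ev (content u) grading) n) x"
          unfolding 2 using 2 by (intro weight_filter_eigenvector[OF e] H_nest grading)
        have "Scale (filter_coeff (sg s * ev (content u) grading) n) x \<approx> Zero"
        proof (cases "u = []")
          case True
          then show ?thesis using 2 by (simp add: Scale_Zero)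
        next
          case False
          \<comment> \<open>The grading eigenvalue is plus or minus \<open>length u\<close>, which
            lies between 1 and \<open>n\<close>, so one factor of the product vanishes.\<close>
          then have "filter_coeff (sg s * ev (content u) grading) n = 0"
            using n 2 by (intro filter_coeff_eq_0[of "length u"])
              (auto simp: root_eval_grading sum_content sg_def Suc_le_eq simp del: of_int_sum)
          then show ?thesis using Scale_0[OF base(2)] by simp
        qed
        from lie_cong.trans[OF lie_cong.trans[OF w this] Z] show ?thesis .
      qed
      then show ?thesis using cartan_0 by blast
    qed
  next
    case Zero
    have "weight_filter ?e n Zero \<approx> Scale (filter_coeff 0 n) Zero" for n
    proof (rule weight_filter_eigenvector[OF e])
      show "Bracket ?e Zero \<approx> Scale 0 Zero"
        by (rule lie_cong.trans[OF Bracket_Zero[OF e] lie_cong.sym[OF Scale_Zero]])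
    qed
    then have "weight_filter ?e n Zero \<approx> Scale (filter_coeff 0 n) (Gen (H (\<lambda>_. 0)))" for n
      by (rule lie_cong.trans[OF lie_cong.trans[OF _ Scale_Zero] Z])
    then show ?case using cartan_0 by blast
  next
    case (Add x y)
    then obtain h h' N N' where h: "h \<in> cartan \<rho>" "h' \<in> cartan \<rho>"
      and x: "\<And>n. n \<ge> N \<Longrightarrow> weight_filter ?e n x \<approx> Scale (filter_coeff 0 n) (Gen (H h))"
      and y: "\<And>n. n \<ge> N' \<Longrightarrow> weight_filter ?e n y \<approx> Scale (filter_coeff 0 n) (Gen (H h'))"
      by blast
    have "weight_filter ?e n (Add x y) \<approx> Scale (filter_coeff 0 n) (Gen (H (\<lambda>k. h k + h' k)))"
      if n: "n \<ge> max N N'" for n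
    proof -
      have "weight_filter ?e n (Add x y) \<approx> Add (weight_filter ?e n x) (weight_filter ?e n y)"
        using Add by (intro weight_filter_Add e) (auto dest: lie_span_exprs)
      also have "\<dots> \<approx> Add (Scale (filter_coeff 0 n) (Gen (H h))) (Scale (filter_coeff 0 n) (Gen (H h')))"
        using n by (intro lie_cong.Add_cong x y) auto
      also have "\<dots> \<approx> Scale (filter_coeff 0 n) (Add (Gen (H h)) (Gen (H h')))"
        using h by (intro lie_cong.sym[OF lie_cong.Scale_Add]) auto
      also have "\<dots> \<approx> Scale (filter_coeff 0 n) (Gen (H (\<lambda>k. h k + h' k)))"
        by (intro lie_cong.Scale_cong H_add h)
      finally show ?thesis .
    qed
    then show ?case using cartan_add[OF h] by blast
  next
    case (Scale x c)
    then obtain h N where h: "h \<in> cartan \<rho>"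
      and x: "\<And>n. n \<ge> N \<Longrightarrow> weight_filter ?e n x \<approx> Scale (filter_coeff 0 n) (Gen (H h))"
      by blast
    have "weight_filter ?e n (Scale c x) \<approx> Scale (filter_coeff 0 n) (Gen (H (\<lambda>k. c * h k)))"
      if n: "n \<ge> N" for n
    proof -
      have "weight_filter ?e n (Scale c x) \<approx> Scale c (weight_filter ?e n x)"
        using Scale by (intro weight_filter_Scale e) (auto dest: lie_span_exprs)
      also have "\<dots> \<approx> Scale c (Scale (filter_coeff 0 n) (Gen (H h)))"
        using n by (intro lie_cong.Scale_cong x)
      also have "\<dots> \<approx> Scale (c * filter_coeff 0 n) (Gen (H h))"
        using h by (intro lie_cong.Scale_Scale) auto
      also have "Scale (c * filter_coeff 0 n) (Gen (H h)) \<approx> Scale (filter_coeff 0 n) (Scale c (Gen (H h)))"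
        using lie_cong.sym[OF lie_cong.Scale_Scale[OF H_exprs[OF h], of rels "filter_coeff 0 n" c]]
        by (simp only: mult.commute)
      also have "\<dots> \<approx> Scale (filter_coeff 0 n) (Gen (H (\<lambda>k. c * h k)))"
        by (intro lie_cong.Scale_cong H_scale h)
      finally show ?thesis .
    qed
    then show ?case using cartan_scale[OF h] by blast
  next
    case (cong x y)
    then show ?case using weight_filter_cong[OF e cong.hyps(2)] by (meson lie_cong.trans)
  }
qed

end

section \<open>The dual of the Verma module over the free algebra\<close>

text \<open>Let the generators act on the words \<open>F i\<^sub>1 \<cdots> F i\<^sub>n v\<close> spanning the Verma-type module
  generated freely over the \<open>F i\<close> by a vector \<open>v\<close> of weight \<open>lam\<close> that is killed by the \<open>E i\<close>.  The
  operators below are the transposed ones, on arbitrary functions of words.  In \<open>act_E c i\<close>, the number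
  \<open>c w\<close> is the eigenvalue on the word \<open>w\<close> of the \<open>i\<close>-th simple coroot.\<close>

fun act_E :: "('i list \<Rightarrow> complex) \<Rightarrow> 'i \<Rightarrow> ('i list \<Rightarrow> complex) \<Rightarrow> 'i list \<Rightarrow> complex" where
  "act_E c i f [] = 0"
| "act_E c i f (j # w) = (if i = j then c w * f w else 0) + act_E c i (\<lambda>z. f (j # z)) w"

definition act_F :: "'i \<Rightarrow> ('i list \<Rightarrow> complex) \<Rightarrow> 'i list \<Rightarrow> complex" where
  "act_F j f = (\<lambda>w. f (j # w))"

definition word_weight ::
    "'i set \<Rightarrow> 'i realization \<Rightarrow> (nat \<Rightarrow> complex) \<Rightarrow> 'i list \<Rightarrow> (nat \<Rightarrow> complex) \<Rightarrow> complex" where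
  "word_weight I \<rho> lam w h = (\<Sum>k<cartan_dim \<rho>. lam k * h k) - root_eval I \<rho> (content w) h"

primrec km_act :: "'i set \<Rightarrow> 'i realization \<Rightarrow> (nat \<Rightarrow> complex) \<Rightarrow> 'i km_gen \<Rightarrow>
    ('i list \<Rightarrow> complex) \<Rightarrow> 'i list \<Rightarrow> complex" where
  "km_act I \<rho> lam (E i) = act_E (\<lambda>w. word_weight I \<rho> lam w (simple_coroot \<rho> i)) i"
| "km_act I \<rho> lam (F i) = act_F i"
| "km_act I \<rho> lam (H h) = (\<lambda>f w. word_weight I \<rho> lam w h * f w)"

text \<open>For \<open>u = [i\<^sub>1, \<dots>, i\<^sub>n]\<close> the functional \<open>v\<^sup>* E i\<^sub>n \<cdots> E i\<^sub>1\<close>, where \<open>v\<^sup>*\<close> is dual to the highest weight vector.\<close>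

primrec vac :: "'i set \<Rightarrow> 'i realization \<Rightarrow> (nat \<Rightarrow> complex) \<Rightarrow> 'i list \<Rightarrow> 'i list \<Rightarrow> complex" where
  "vac I \<rho> lam [] = (\<lambda>w. if w = [] then 1 else 0)"
| "vac I \<rho> lam (i # u) = km_act I \<rho> lam (E i) (vac I \<rho> lam u)"

lemma linear_act_E: "linear_op (act_E c i)"
proof -
  have "act_E c i (\<lambda>w. f w + g w) w = act_E c i f w + act_E c i g w" for f g w
    by (induction w arbitrary: f g) (auto simp: algebra_simps)
  moreover have "act_E c i (\<lambda>w. a * f w) w = a * act_E c i f w" for a f w
    by (induction w arbitrary: f) (auto simp: algebra_simps)
  ultimately show ?thesis by (auto simp: linear_op_def)
qed

lemma linear_km_act: "linear_op (km_act I \<rho> lam g)"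
  by (cases g) (auto simp: linear_act_E, auto simp: linear_op_def act_F_def algebra_simps)

text \<open>Each term of the recursion deletes one occurrence of \<open>i\<close> from the word
  before evaluating \<open>f\<close>.\<close>

lemma act_E_nonzero: "act_E c i f w \<noteq> 0 \<Longrightarrow> \<exists>a b. w = a @ i # b \<and> f (a @ b) \<noteq> 0"
proof (induction w arbitrary: f)
  case (Cons j w)
  show ?case
  proof (cases "i = j \<and> f w \<noteq> 0")
    case True
    then show ?thesis by (metis append_Nil)
  next
    case False
    then have "act_E c i (\<lambda>z. f (j # z)) w \<noteq> 0" using Cons.prems by (auto split: if_splits)
    from Cons.IH[OF this] show ?thesis by (metis append_Cons)
  qed
qed simp

text \<open>\<open>act_E c i\<close> reads its argument only at words with one \<open>i\<close>
  deleted, so a factor constant on these moves outside. With a word weight as \<open>g\<close> this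
  gives the relation between \<open>H\<close> and \<open>E\<close>.\<close>

lemma act_E_mult:
  "(\<And>a b. w = a @ i # b \<Longrightarrow> g (a @ b) = K) \<Longrightarrow> act_E c i (\<lambda>z. g z * f z) w = K * act_E c i f w"
proof (induction w arbitrary: f g)
  case (Cons j w)
  have 1: "i = j \<Longrightarrow> g w = K" using Cons.prems[of "[]" w] by simp
  have "act_E c i (\<lambda>z. g (j # z) * f (j # z)) w = K * act_E c i (\<lambda>z. f (j # z)) w"
    using Cons.prems[of "j # _"] by (intro Cons.IH) simp
  then show ?case using 1 by (simp add: algebra_simps)
qed simp

lemma act_E_agree:
  assumes "\<And>z. z \<in> lists L \<Longrightarrow> c z = c' z" "\<And>z. z \<in> lists L \<Longrightarrow> f z = f' z" "w \<in> lists L"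
  shows "act_E c i f w = act_E c' i f' w"
  using assms(2,3)
proof (induction w arbitrary: f f' rule: list.induct)
  case (Cons j w)
  then have "act_E c i (\<lambda>z. f (j # z)) w = act_E c' i (\<lambda>z. f' (j # z)) w"
    by (intro Cons.IH) auto
  moreover have "c w = c' w" "f w = f' w" using Cons.prems assms(1) by auto
  ultimately show ?case by simp
qed simp

context km_presentation
begin

abbreviation "wt \<equiv> word_weight I \<rho>"
abbreviation "rep lam \<equiv> lie_act (km_act I \<rho> lam)"
abbreviation "vc \<equiv> vac I \<rho>"
abbreviation "rad \<equiv> km_radical I \<rho>"

lemmas rep_linear = linear_op_lie_act[of "km_act I \<rho> lam" for lam, OF linear_km_act]

lemma pairing_add: "pairing \<rho> i (\<lambda>k. h k + h' k) = pairing \<rho> i h + pairing \<rho> i h'"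
  and pairing_scale: "pairing \<rho> i (\<lambda>k. c * h k) = c * pairing \<rho> i h"
  by (simp_all add: pairing_def algebra_simps sum.distrib sum_distrib_left)

lemma wt_add: "wt lam w (\<lambda>k. h k + h' k) = wt lam w h + wt lam w h'"
  and wt_scale: "wt lam w (\<lambda>k. c * h k) = c * wt lam w h"
  by (simp_all add: word_weight_def root_eval_def pairing_add pairing_scale algebra_simps
      sum.distrib sum_distrib_left)

lemma wt_Cons: "i \<in> I \<Longrightarrow> wt lam (i # w) h = wt lam w h - pairing \<rho> i h"
  by (simp add: word_weight_def content_Cons root_eval_add root_eval_simple)

lemma wt_delete: "i \<in> I \<Longrightarrow> wt lam (a @ b) h = wt lam (a @ i # b) h + pairing \<rho> i h"
  by (simp add: word_weight_def content_append content_Cons root_eval_add root_eval_simple)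

text \<open>The relations between \<open>E\<close> and \<open>F\<close> are built into the recursion
  of \<open>act_E\<close>, those between \<open>H\<close> and \<open>F\<close> are
  \<open>wt_Cons\<close>, and those between \<open>H\<close> and \<open>E\<close> come from
  \<open>HE\<close>.\<close>

lemma rep_relation:
  assumes "(x, y) \<in> rels"
  shows "rep lam x = rep lam y"
proof -
  have HE: "act_E c i (\<lambda>w. f w * wt lam w h) w
      = pairing \<rho> i h * act_E c i f w + wt lam w h * act_E c i f w" if "i \<in> I" for c i h f w
  proof -
    have "act_E c i (\<lambda>w. wt lam w h * f w) w = (wt lam w h + pairing \<rho> i h) * act_E c i f w"
      by (intro act_E_mult) (simp only: wt_delete[OF that, symmetric])
    then show ?thesis by (simp add: algebra_simps)
  qed
  show ?thesis
    using assms unfolding km_relations_def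
    by (elim UnE CollectE exE conjE)
      (auto simp: fun_eq_iff act_F_def wt_add wt_scale wt_Cons HE algebra_simps)
qed

lemma rep_cong: "x \<approx> y \<Longrightarrow> rep lam x = rep lam y"
  by (rule lie_act_cong[OF linear_km_act rep_relation])

lemma rep_zero [simp]: "rep lam x (\<lambda>_. 0) = (\<lambda>_. 0)"
  by (rule linear_op_zero[OF rep_linear])

section \<open>Weights of functionals\<close>

definition supp :: "('i \<Rightarrow> int) \<Rightarrow> ('i list \<Rightarrow> complex) \<Rightarrow> bool" where
  "supp \<beta> f \<longleftrightarrow> (\<forall>w. f w \<noteq> 0 \<longrightarrow> content w = \<beta>)"

lemma supp_E: "supp \<beta> f \<Longrightarrow> supp (\<lambda>k. \<beta> k + simple_root i k) (act_E c i f)"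
  by (force simp: supp_def content_append content_Cons dest!: act_E_nonzero)

lemma supp_F: "supp \<beta> f \<Longrightarrow> supp (\<lambda>k. \<beta> k - simple_root i k) (act_F i f)"
  by (force simp: supp_def act_F_def content_Cons)

lemma supp_diff: "supp \<beta> f \<Longrightarrow> supp \<beta> g \<Longrightarrow> supp \<beta> (\<lambda>w. f w - g w)"
  unfolding supp_def by (metis diff_self)

lemma supp_vac: "supp (content u) (vc lam u)"
proof (induction u)
  case (Cons i u)
  from supp_E[OF this] show ?case by (simp add: content_Cons)
qed (simp add: supp_def)

lemma vac_H: "rep lam (Gen (H h)) (vc lam u) = (\<lambda>w. wt lam u h * vc lam u w)"
  using supp_vac[of u lam] by (force simp: supp_def word_weight_def)

definition sgi :: "bool \<Rightarrow> int" where
  "sgi s = (if s then 1 else -1)"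

lemma supp_root_gen:
  "supp \<beta> f \<Longrightarrow> supp (\<lambda>k. \<beta> k + sgi s * simple_root i k) (rep lam (root_gen s i) f)"
  using supp_E[of \<beta> f i] supp_F[of \<beta> f i] by (auto simp: root_gen_def sgi_def)

lemma supp_nest: "supp \<beta> f \<Longrightarrow> supp (\<lambda>k. \<beta> k + sgi s * content v k) (rep lam (nest s v) f)"
proof (induction s v arbitrary: \<beta> f rule: nest.induct)
  case (1 s)
  show ?case by (simp add: supp_def)
next
  case (2 s i)
  then show ?case using supp_root_gen by (simp add: content_Cons)
next
  case (3 s i j u)
  have "supp (\<lambda>k. \<beta> k + sgi s * content (i # j # u) k)
      (rep lam (nest s (j # u)) (rep lam (root_gen s i) f))"
    using "3.IH"[OF supp_root_gen[OF "3.prems"]]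
    by (simp add: content_Cons[of i] algebra_simps)
  moreover have "supp (\<lambda>k. \<beta> k + sgi s * content (i # j # u) k)
      (rep lam (root_gen s i) (rep lam (nest s (j # u)) f))"
    using supp_root_gen[OF "3.IH"[OF "3.prems"]]
    by (simp add: content_Cons[of i] algebra_simps)
  ultimately show ?case by (auto intro: supp_diff)
qed

text \<open>The right module generated by the vacuum functional: the lemmas below show this span to
  be stable under all generators. Its members vanish on words with letters outside
  \<open>I\<close>.\<close>

inductive covec :: "(nat \<Rightarrow> complex) \<Rightarrow> ('i list \<Rightarrow> complex) \<Rightarrow> bool" for lam where
  vac: "u \<in> lists I \<Longrightarrow> covec lam (vc lam u)"
| add: "covec lam f \<Longrightarrow> covec lam g \<Longrightarrow> covec lam (\<lambda>w. f w + g w)"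
| scale: "covec lam f \<Longrightarrow> covec lam (\<lambda>w. c * f w)"

lemma covec_diff: "covec lam f \<Longrightarrow> covec lam g \<Longrightarrow> covec lam (\<lambda>w. f w - g w)"
  using covec.add[OF _ covec.scale[of lam g "-1"]] by force

lemma covec_zero: "covec lam (\<lambda>_. 0)"
  using covec.scale[OF covec.vac[of "[]" lam], of 0] by simp

lemma covec_linear:
  assumes T: "linear_op T" and vac: "\<And>u. u \<in> lists I \<Longrightarrow> covec lam (T (vc lam u))"
    and f: "covec lam f"
  shows "covec lam (T f)"
  using f
  by (induction rule: covec.induct)
    (auto simp: linear_op_add[OF T] linear_op_scale[OF T] intro: covec.intros vac)

lemma covec_H: "covec lam f \<Longrightarrow> covec lam (rep lam (Gen (H h)) f)"
  by (erule covec_linear[OF rep_linear, rotated]) (auto simp only: vac_H intro: covec.intros)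

lemma covec_E: "i \<in> I \<Longrightarrow> covec lam f \<Longrightarrow> covec lam (rep lam (Gen (E i)) f)"
proof (erule covec_linear[OF rep_linear, rotated])
  fix u assume "i \<in> I" "u \<in> lists I"
  then show "covec lam (rep lam (Gen (E i)) (vc lam u))"
    using covec.vac[of "i # u" lam] by simp
qed

lemma act_F_E:
  assumes "i \<in> I"
  shows "act_F j (rep lam (Gen (E i)) f) = (\<lambda>w. rep lam (Gen (E i)) (act_F j f) w +
    (if i = j then 1 else 0) * rep lam (Gen (H (coroot i))) f w)"
  by (auto simp: act_F_def)

text \<open>\<open>F j\<close> is moved past each \<open>E i\<close> towards the vacuum functional,
  which it kills; every exchange costs a Cartan term, by \<open>act_F_E\<close>.\<close>

lemma covec_F: "j \<in> I \<Longrightarrow> covec lam f \<Longrightarrow> covec lam (rep lam (Gen (F j)) f)"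
proof (erule covec_linear[OF rep_linear, rotated])
  fix u assume j: "j \<in> I" and "u \<in> lists I"
  then show "covec lam (rep lam (Gen (F j)) (vc lam u))"
  proof (induction u rule: list.induct)
    case Nil
    then show ?case using covec_zero by (simp add: act_F_def)
  next
    case (Cons i u)
    then have i: "i \<in> I" and u: "u \<in> lists I" by auto
    have eq: "rep lam (Gen (F j)) (vc lam (i # u)) =
        (\<lambda>w. rep lam (Gen (E i)) (rep lam (Gen (F j)) (vc lam u)) w +
          (if i = j then 1 else 0) * rep lam (Gen (H (coroot i))) (vc lam u) w)"
      using act_F_E[OF i, of j lam "vc lam u"] by simp
    show ?case
      unfolding eq using Cons u by (intro covec.add covec.scale covec_E covec_H covec.vac i) auto
  qed
qed

lemma covec_rep: "x \<in> exprs \<Longrightarrow> covec lam f \<Longrightarrow> covec lam (rep lam x f)"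
proof (induction x arbitrary: f)
  case (Gen g)
  then show ?case
    using covec_E covec_F covec_H unfolding km_gens_def by (auto simp del: lie_act.simps(1))
next
  case Zero
  then show ?case using covec_zero by simp
next
  case (Add x y)
  then show ?case by (auto intro: covec.add)
next
  case (Scale c x)
  then show ?case by (auto intro: covec.scale)
next
  case (Bracket x y)
  then show ?case by (auto intro: covec_diff)
qed

lemma covec_words: "covec lam f \<Longrightarrow> f w \<noteq> 0 \<Longrightarrow> w \<in> lists I"
proof (induction rule: covec.induct)
  case (vac u)
  then have "content w = content u" using supp_vac unfolding supp_def by blast
  then have "set w = set u" using content_nonzero_iff by (metis subsetI subset_antisym)
  then show ?case using vac by auto
next
  case (add f g)
  then show ?case by (cases "f w = 0") auto
qed auto

definition annihilator :: "'i km_gen lie_expr set" where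
  "annihilator = {x \<in> exprs. \<forall>lam. \<forall>u\<in>lists I. rep lam x (vc lam u) = (\<lambda>_. 0)}"

lemma annihilator_covec:
  assumes "x \<in> annihilator" "covec lam f"
  shows "rep lam x f = (\<lambda>_. 0)"
  using assms(2)
proof (induction rule: covec.induct)
  case (vac u)
  then show ?case using assms(1) by (simp add: annihilator_def)
qed (simp_all add: linear_op_add[OF rep_linear] linear_op_scale[OF rep_linear])

lemma annihilator_ideal: "lie_ideal gs rels annihilator"
  unfolding lie_ideal_def
proof (intro conjI ballI allI impI)
  fix x y assume "x \<in> annihilator" "x \<approx> y"
  then show "y \<in> annihilator"
    using rep_cong[of x y] lie_cong_exprs[of gs rels x y] by (auto simp: annihilator_def)
next
  fix x y assume x: "x \<in> annihilator" and y: "y \<in> exprs"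
  have "rep lam (Bracket y x) (vc lam u) = (\<lambda>_. 0)" if "u \<in> lists I" for lam u
    using annihilator_covec[OF x covec_rep[OF y covec.vac[OF that]]]
      annihilator_covec[OF x covec.vac[OF that]] by simp
  then show "Bracket y x \<in> annihilator"
    using x y by (simp add: annihilator_def)
qed (auto simp: annihilator_def)

lemma annihilator_cartan: "meets_cartan_trivially I \<rho> annihilator"
  unfolding meets_cartan_trivially_def
proof (intro ballI impI)
  fix h assume h: "h \<in> cartan \<rho>" and K: "Gen (H h) \<in> annihilator"
  have "h k = 0" if "k < cartan_dim \<rho>" for k
  proof -
    \<comment> \<open>The highest weight that reads off the \<open>k\<close>-th coordinate: the
      vacuum coefficient of \<open>Gen (H h)\<close> becomes \<open>h k\<close>.\<close>
    let ?l = "\<lambda>j. if j = k then 1 else (0::complex)"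
    have "rep ?l (Gen (H h)) (vc ?l []) = (\<lambda>_. 0)"
      by (intro annihilator_covec[OF K] covec.vac) simp
    then have "rep ?l (Gen (H h)) (vc ?l []) [] = 0" by (rule fun_cong)
    then have "(\<Sum>j<cartan_dim \<rho>. ?l j * h j) = 0" by (simp add: word_weight_def)
    moreover have "(\<Sum>j<cartan_dim \<rho>. ?l j * h j) = (\<Sum>j<cartan_dim \<rho>. if j = k then h j else 0)"
      by (intro sum.cong) auto
    ultimately show ?thesis using that by simp
  qed
  then have "h k = 0" for k using h by (cases "k < cartan_dim \<rho>") (auto simp: cartan_def)
  then have "h = (\<lambda>_. 0)" by (rule ext)
  then show "Gen (H h) \<approx> Zero" using H_0 by simp
qed

text \<open>A bracket with a Cartan element has vacuum coefficient zero, because the vacuum on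
  either side carries the same weight. So only the scalar term of each filter factor
  survives.\<close>

lemma rep_weight_filter:
  "rep lam (weight_filter (Gen (H h)) n x) (vc lam []) [] = filter_coeff 0 n * rep lam x (vc lam []) []"
proof (induction n)
  case (Suc n)
  have "rep lam (Bracket (Gen (H h)) y) (vc lam []) [] = 0" for y
    unfolding lie_act.simps(5) vac_H linear_op_scale[OF rep_linear] by simp
  with Suc show ?case
    by (simp del: lie_act.simps(5) vac.simps add: filter_coeff_def)
qed (simp add: filter_coeff_def)

lemma ideal_swap:
  assumes J: "lie_ideal gs rels J" and "x \<in> J" "y \<in> exprs"
  shows "Bracket x y \<in> J"
proof -
  have "Scale (-1) (Bracket y x) \<in> J" "x \<in> exprs" using assms by (auto simp: lie_ideal_def)
  moreover have "Scale (-1) (Bracket y x) \<approx> Bracket x y"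
    using \<open>x \<in> exprs\<close> assms(3) by (intro lie_cong.sym[OF Bracket_antisym])
  ultimately show ?thesis using J unfolding lie_ideal_def by blast
qed

text \<open>The filter keeps \<open>x\<close> inside the ideal and turns it into a nonzero multiple
  of its Cartan component, while scaling the vacuum coefficient by a nonzero number. The Cartan
  component then lies in the ideal, hence is zero.\<close>

lemma ideal_vacuum:
  assumes J: "lie_ideal gs rels J" and triv: "meets_cartan_trivially I \<rho> J" and x: "x \<in> J"
  shows "rep lam x (vc lam []) [] = 0"
proof -
  have cong: "a \<in> J \<Longrightarrow> a \<approx> b \<Longrightarrow> b \<in> J" for a b
    using J unfolding lie_ideal_def by blast
  have scale: "a \<in> J \<Longrightarrow> Scale c a \<in> J" for a c
    using J unfolding lie_ideal_def by blast
  have "x \<in> exprs" using J x unfolding lie_ideal_def by blast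
  from weight_filter_zero_part[OF span_tri[OF this]] obtain h N where h: "h \<in> cartan \<rho>"
    and N: "weight_filter (Gen (H grading)) N x \<approx> Scale (filter_coeff 0 N) (Gen (H h))"
    by blast
  let ?c = "filter_coeff 0 N"
  have "weight_filter (Gen (H grading)) N x \<in> J"
    using grading by (intro weight_filter_ideal[OF _ J x]) simp
  then have "Scale (1 / ?c) (Scale ?c (Gen (H h))) \<in> J"
    by (intro scale cong[OF _ N])
  moreover have "Scale (1 / ?c) (Scale ?c (Gen (H h))) \<approx> Scale (1 / ?c * ?c) (Gen (H h))"
    using h by (intro lie_cong.Scale_Scale) simp
  moreover have "Scale (1 / ?c * ?c) (Gen (H h)) \<approx> Gen (H h)"
    using h filter_coeff_0_nonzero[of N] by (simp add: lie_cong.Scale_one)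
  ultimately have "Gen (H h) \<in> J" using cong by blast
  then have "Gen (H h) \<approx> Zero" using triv h by (simp add: meets_cartan_trivially_def)
  then have "weight_filter (Gen (H grading)) N x \<approx> Zero"
    using N Scale_cong_Zero lie_cong.trans by metis
  then have "rep lam (weight_filter (Gen (H grading)) N x) (vc lam []) [] = 0"
    using rep_cong by fastforce
  then show ?thesis unfolding rep_weight_filter using filter_coeff_0_nonzero by simp
qed

lemma act_F_vacuum: "rep lam (Gen (F j)) (vc lam []) = (\<lambda>_. 0)"
  by (simp add: act_F_def)

text \<open>Every coefficient of \<open>x\<close> is traded for vacuum coefficients of brackets of
  \<open>x\<close> with generators, which stay in the ideal.\<close>

lemma ideal_annihilates:
  assumes J: "lie_ideal gs rels J" and triv: "meets_cartan_trivially I \<rho> J"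
  shows "J \<subseteq> annihilator"
proof
  fix x assume x: "x \<in> J"
  have JX: "x \<in> exprs" if "x \<in> J" for x
    using J that unfolding lie_ideal_def by blast
  have 1: "rep lam x (vc lam []) w = 0" if "x \<in> J" for lam x w
    using that
  proof (induction w arbitrary: x)
    case Nil
    then show ?case by (rule ideal_vacuum[OF J triv])
  next
    case (Cons j w)
    show ?case
    proof (cases "j \<in> I")
      case True
      then have "Gen (F j) \<in> exprs" by (simp add: km_gens_def)
      \<comment> \<open>As \<open>F j\<close> kills the vacuum functional, the coefficient of this
        bracket at \<open>w\<close> is that of \<open>x\<close> at \<open>j # w\<close>.\<close>
      then have "rep lam (Bracket x (Gen (F j))) (vc lam []) w = 0"
        by (intro Cons.IH ideal_swap[OF J Cons.prems])
      then show ?thesis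
        unfolding lie_act.simps(5) act_F_vacuum by (simp add: act_F_def)
    next
      case False
      have "covec lam (rep lam x (vc lam []))"
        by (intro covec_rep covec.vac JX Cons.prems) simp
      from covec_words[OF this, of "j # w"] False show ?thesis by auto
    qed
  qed
  have "rep lam x (vc lam u) = (\<lambda>_. 0)" if "u \<in> lists I" "x \<in> J" for lam u x
    using that
  proof (induction u arbitrary: x rule: list.induct)
    case Nil
    then show ?case using 1 by auto
  next
    case (Cons i u)
    then have i: "Gen (E i) \<in> exprs" and u: "u \<in> lists I" by (auto simp: km_gens_def)
    \<comment> \<open>The functional for \<open>i # u\<close> is that for \<open>u\<close> followed
      by \<open>E i\<close>; exchanging \<open>E i\<close> with \<open>x\<close> costs this
      bracket.\<close>
    have "Bracket (Gen (E i)) x \<in> J" using J Cons.prems i unfolding lie_ideal_def by blast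
    then have "rep lam (Bracket (Gen (E i)) x) (vc lam u) = (\<lambda>_. 0)" by (rule Cons.IH[OF u])
    moreover have "rep lam (Gen (E i)) (rep lam x (vc lam u)) = (\<lambda>_. 0)"
      unfolding Cons.IH[OF u Cons.prems(2)] by (rule rep_zero)
    ultimately show ?case by (simp add: fun_eq_iff)
  qed
  then show "x \<in> annihilator" using x JX by (simp add: annihilator_def)
qed

lemma km_radical_eq: "rad = annihilator"
  unfolding km_radical_def
  using ideal_annihilates annihilator_ideal annihilator_cartan by blast

lemma rad_vac: "x \<in> rad \<Longrightarrow> u \<in> lists I \<Longrightarrow> rep lam x (vc lam u) w = 0"
  by (simp add: km_radical_eq annihilator_def)

end

section \<open>Roots\<close>

context km_presentation
begin

lemma rep_H_Bracket:
  "rep lam (Bracket (Gen (H h)) x) (vc lam u) w =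
     (ev (content w) h - ev (content u) h) * rep lam x (vc lam u) w"
  unfolding lie_act.simps(5) vac_H linear_op_scale[OF rep_linear]
  by (simp add: word_weight_def algebra_simps)

lemma rad_vac_iff:
  "x \<in> rad \<longleftrightarrow> x \<in> exprs \<and> (\<forall>lam. \<forall>u\<in>lists I. \<forall>w. rep lam x (vc lam u) w = 0)"
  by (auto simp: km_radical_eq annihilator_def fun_eq_iff)

lemma supp_nest_vac:
  assumes "rep lam (nest s v) (vc lam u) w \<noteq> 0"
  shows "content w = (\<lambda>k. content u k + sgi s * content v k)"
  using supp_nest[OF supp_vac[of u lam], of s v lam] assms unfolding supp_def by blast

lemma rep_words:
  assumes "x \<in> exprs" "u \<in> lists I" "rep lam x (vc lam u) w \<noteq> 0"
  shows "w \<in> lists I"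
  using covec_words[OF covec_rep[OF assms(1) covec.vac[OF assms(2)]] assms(3)] .

text \<open>A nonzero coefficient of \<open>x\<close> between \<open>u\<close> and \<open>w\<close>
  forces their contents to differ by \<open>\<alpha>\<close>, and elements of other weights
  contribute nothing at this place. Expanding \<open>x\<close> over \<open>tri_set\<close>, some
  nest of weight \<open>\<alpha>\<close> must contribute, so it is outside the radical.\<close>

lemma root_is_nest_weight:
  assumes \<alpha>: "\<alpha> \<in> root_lattice I" "\<alpha> \<noteq> (\<lambda>_. 0)"
    and x: "x \<in> root_space I \<rho> \<alpha>" "x \<notin> rad"
  shows "\<exists>s v. v \<in> lists I \<and> \<alpha> = (\<lambda>k. sgi s * content v k) \<and> nest s v \<notin> rad"
proof (rule ccontr)
  assume "\<not> ?thesis"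
  then have all: "nest s v \<in> rad" if "v \<in> lists I" "\<alpha> = (\<lambda>k. sgi s * content v k)" for s v
    using that by blast
  have x': "x \<in> exprs" using x(1) by (simp add: root_space_def)
  then obtain lam u w where u: "u \<in> lists I" and nz: "rep lam x (vc lam u) w \<noteq> 0"
    using x(2) by (auto simp: rad_vac_iff)
  have w: "w \<in> lists I" using rep_words[OF x' u nz] .
  have "ev (\<lambda>k. content w k - content u k) h = ev \<alpha> h" if h: "h \<in> cartan \<rho>" for h
  proof -
    have "Add (Bracket (Gen (H h)) x) (Scale (- ev \<alpha> h) x) \<in> rad"
      using x(1) h by (simp add: root_space_def)
    then have "rep lam (Add (Bracket (Gen (H h)) x) (Scale (- ev \<alpha> h) x)) (vc lam u) w = 0"
      using u by (rule rad_vac)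
    then have "rep lam (Bracket (Gen (H h)) x) (vc lam u) w - ev \<alpha> h * rep lam x (vc lam u) w = 0"
      by simp
    then have "(ev (content w) h - ev (content u) h - ev \<alpha> h) * rep lam x (vc lam u) w = 0"
      unfolding rep_H_Bracket by (simp add: algebra_simps)
    then show ?thesis using nz by (simp add: root_eval_diff)
  qed
  then have I: "content w k - content u k = \<alpha> k" if "k \<in> I" for k
    using root_eval_inj[of "\<lambda>k. content w k - content u k" \<alpha>] that by blast
  have wu: "content w k = content u k + \<alpha> k" for k
  proof (cases "k \<in> I")
    case True
    then show ?thesis using I[of k] by simp
  next
    case False
    then have "k \<notin> set w" "k \<notin> set u" using u w by auto
    then have "content w k = 0" "content u k = 0" using content_nonzero_iff[of w k] content_nonzero_iff[of u k] by auto
    then show ?thesis using \<alpha>(1) False by (simp add: root_lattice_def)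
  qed
  have "rep lam y (vc lam u) w = 0" if "lspan tri_set y" for y
    using that
  proof (induction rule: lie_span.induct)
    case (base y)
    then consider h where "h \<in> cartan \<rho>" "y = Gen (H h)" | s v where "v \<in> lists I" "y = nest s v"
      by (auto simp: tri_set_def H_set_def nests_def)
    then show ?case
    proof cases
      case (1 h)
      have "vc lam u w = 0"
      proof (rule ccontr)
        assume "vc lam u w \<noteq> 0"
        then have "content w = content u" using supp_vac unfolding supp_def by blast
        then have "\<alpha> = (\<lambda>_. 0)" using wu by auto
        then show False using \<alpha>(2) by simp
      qed
      then show ?thesis using 1 by simp
    next
      case (2 s v)
      show ?thesis
      proof (rule ccontr)
        assume nz: "rep lam y (vc lam u) w \<noteq> 0"
        then have "\<alpha> = (\<lambda>k. sgi s * content v k)"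
          using supp_nest_vac[of lam s v u w] 2 wu by auto
        then have "y \<in> rad" using 2 all by simp
        then show False using rad_vac[OF _ u] nz by blast
      qed
    qed
  next
    case (cong x y)
    then show ?case using rep_cong by metis
  qed simp_all
  then show False using nz span_tri[OF x'] by blast
qed

lemma nest_weight_is_root:
  assumes v: "v \<in> lists I" and nest: "nest s v \<notin> rad"
  shows "(\<lambda>k. sgi s * content v k) \<in> root_lattice I"
    and "(\<lambda>k. sgi s * content v k) \<noteq> (\<lambda>_. 0)"
    and "nest s v \<in> root_space I \<rho> (\<lambda>k. sgi s * content v k)"
proof -
  have Zero: "Zero \<in> rad" using annihilator_ideal by (simp add: km_radical_eq lie_ideal_def)
  show "(\<lambda>k. sgi s * content v k) \<in> root_lattice I"
    using v content_nonzero_iff by (fastforce simp: root_lattice_def)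
  have "v \<noteq> []" using nest Zero by auto
  then obtain i where "i \<in> set v" by (meson last_in_set)
  then have "content v i \<noteq> 0" by (simp add: content_nonzero_iff)
  then have "sgi s * content v i \<noteq> 0" by (simp add: sgi_def)
  then show "(\<lambda>k. sgi s * content v k) \<noteq> (\<lambda>_. 0)" by metis
  have ev: "ev (\<lambda>k. sgi s * content v k) h = sg s * ev (content v) h" for h
    by (simp add: sgi_def sg_def root_eval_uminus)
  have "Add (Bracket (Gen (H h)) (nest s v)) (Scale (- ev (\<lambda>k. sgi s * content v k) h) (nest s v)) \<in> rad"
    if h: "h \<in> cartan \<rho>" for h
  proof -
    let ?c = "sg s * ev (content v) h"
    have "rep lam (Bracket (Gen (H h)) (nest s v)) = rep lam (Scale ?c (nest s v))" for lam
      by (rule rep_cong[OF H_nest[OF h v]])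
    then show ?thesis
      using h v by (simp add: rad_vac_iff ev del: lie_act.simps(5))
  qed
  then show "nest s v \<in> root_space I \<rho> (\<lambda>k. sgi s * content v k)"
    using v by (simp add: root_space_def)
qed

section \<open>One-sided tests for membership in the radical\<close>

lemma rep_span_coroot:
  assumes "lspan {Gen (H h)} y"
  shows "\<exists>c. \<forall>lam f w. rep lam y f w = c * wt lam w h * f w"
  using assms
proof (induction rule: lie_span.induct)
  case (base x)
  then show ?case by (intro exI[of _ 1]) simp
next
  case Zero
  show ?case by (intro exI[of _ 0]) simp
next
  case (Add x y)
  then obtain c d where "\<forall>lam f w. rep lam x f w = c * wt lam w h * f w"
    "\<forall>lam f w. rep lam y f w = d * wt lam w h * f w" by blast
  then show ?case by (intro exI[of _ "c + d"]) (simp add: algebra_simps)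
next
  case (Scale x a)
  then obtain c where "\<forall>lam f w. rep lam x f w = c * wt lam w h * f w" by blast
  then show ?case by (intro exI[of _ "a * c"]) (simp add: algebra_simps)
next
  case (cong x y)
  then show ?case using rep_cong by metis
qed

text \<open>On the line of one coroot an element acts by a fixed scalar times the weight at that
  coroot; a highest weight with value 1 there shows the scalar to be zero.\<close>

lemma rep_span_coroot_zero:
  assumes y: "lspan {Gen (H (coroot j))} y" and j: "j \<in> I"
    and vac: "\<And>lam. rep lam y (vc lam []) [] = 0"
  shows "rep lam y f w = 0"
proof -
  obtain c where c: "\<forall>lam f w. rep lam y f w = c * wt lam w (coroot j) * f w"
    using rep_span_coroot[OF y] by blast
  obtain l :: "nat \<Rightarrow> complex" where l: "\<And>i. i \<in> I \<Longrightarrow> (\<Sum>k<cartan_dim \<rho>. l k * coroot i k) = 1"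
    using coroot_dual[of "\<lambda>_. 1"] by blast
  have "c = 0"
    using vac[of l] l[OF j] c by (simp add: word_weight_def)
  then show ?thesis using c by simp
qed

text \<open>Sharper than landing in \<open>H_set\<close>: brackets with one fixed generator stay on
  one coroot line, as \<open>rep_span_coroot_zero\<close> requires.\<close>

lemma lspan_opposite_1:
  assumes j: "j \<in> I" and "lspan (nests s 1) x"
  shows "lspan {Gen (H (coroot j))} (Bracket (root_gen (\<not> s) j) x)"
proof (rule lie_span_Bracket_right[OF _ _ assms(2)])
  fix b :: "'i km_gen lie_expr" assume "b \<in> nests s 1"
  then obtain i where i: "i \<in> I" "b = root_gen s i"
    by (auto simp: nests_def length_Suc_conv)
  show "lspan {Gen (H (coroot j))} (Bracket (root_gen (\<not> s) j) b)"
  proof (rule lie_span.cong)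
    show "Bracket (root_gen (\<not> s) j) b \<approx>
        (if j = i then Scale (sg (\<not> s)) (Gen (H (coroot j))) else Zero)"
      using root_gen_opposite[OF j i(1), of "\<not> s"] i by simp
  qed (use j coroot_cartan in \<open>auto intro!: lie_span.Zero lie_span.Scale lie_span.base\<close>)
qed (use j in simp)

lemma lspan_opposite_Suc:
  assumes j: "j \<in> I" and "lspan (nests s (Suc (Suc n))) x"
  shows "lspan (nests s (Suc n)) (Bracket (root_gen (\<not> s) j) x)"
proof (rule lie_span_Bracket_right[OF _ _ assms(2)])
  fix b :: "'i km_gen lie_expr" assume "b \<in> nests s (Suc (Suc n))"
  then show "lspan (nests s (Suc n)) (Bracket (root_gen (\<not> s) j) b)"
    using span_opposite_nest[OF j] by (auto simp: nests_def)
qed (use j in simp)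

lemma rep_nest_True_Nil: "rep lam (nest True v) f [] = 0"
  by (induction "True" v arbitrary: f rule: nest.induct) (auto simp: root_gen_def)

lemma rep_span_True_Nil: "lspan (nests True n) x \<Longrightarrow> rep lam x f [] = 0"
proof (induction rule: lie_span.induct)
  case (base x)
  then show ?case using rep_nest_True_Nil by (auto simp: nests_def)
next
  case (cong x y)
  then show ?case using rep_cong by metis
qed simp_all

lemma rep_nest_False_vac: "rep lam (nest False v) (vc lam []) = (\<lambda>_. 0)"
  by (induction "False" v rule: nest.induct) (auto simp: root_gen_def act_F_def)

lemma rep_span_False_vac: "lspan (nests False n) x \<Longrightarrow> rep lam x (vc lam []) = (\<lambda>_. 0)"
proof (induction rule: lie_span.induct)
  case (base x)
  then show ?case using rep_nest_False_vac by (auto simp: nests_def simp del: vac.simps)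
next
  case (cong x y)
  then show ?case using rep_cong by metis
qed (simp_all del: vac.simps)

text \<open>For the membership in the radical, the raising monomials only have to be tested against the
  vacuum on the left and the lowering ones only against the vacuum on the right.  Then all letters
  of the words involved occur in the monomial, which makes the test independent of the ambient
  diagram.\<close>

lemma raising_test:
  assumes "lspan (nests True (Suc n)) x" "\<And>lam w. rep lam x (vc lam []) w = 0" "covec lam f"
  shows "rep lam x f w = 0"
  using assms
proof (induction n arbitrary: x f w)
  case (0 x f w)
  have step: "rep lam (Bracket (root_gen False j) x) f w = 0" if j: "j \<in> I" for j f w
  proof (rule rep_span_coroot_zero[OF _ j])
    show "lspan {Gen (H (coroot j))} (Bracket (root_gen False j) x)"
      using lspan_opposite_1[OF j, of True] 0(1) by simp
    show "rep lam (Bracket (root_gen False j) x) (vc lam []) [] = 0" for lam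
      using 0(2) by (simp add: root_gen_def act_F_def)
  qed
  show ?case
    using 0(3)
  proof (induction w arbitrary: f)
    case Nil
    show ?case by (rule rep_span_True_Nil[OF 0(1)])
  next
    case (Cons j w)
    show ?case
    proof (cases "j \<in> I")
      case True
      \<comment> \<open>Because the bracket with \<open>F j\<close> acts by zero, \<open>x\<close>
        commutes with \<open>F j\<close> here, and the value at \<open>j # w\<close> is read off at
        \<open>w\<close>. At the empty word a raising element gives zero.\<close>
      have "rep lam x (rep lam (Gen (F j)) f) w = 0"
        by (intro Cons.IH covec_F True Cons.prems)
      then show ?thesis using step[OF True, of f w] by (simp add: root_gen_def act_F_def)
    next
      case False
      then show ?thesis
        using covec_words[OF covec_rep[OF lie_span_exprs[OF 0(1)] Cons.prems], of "j # w"] by auto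
    qed
  qed
next
  case (Suc n x f w)
  \<comment> \<open>The bracket is in the span of nests one letter shorter, and it kills the vacuum
    functional because both \<open>F j\<close> and \<open>x\<close> do; so the outer induction
    applies.\<close>
  have step: "rep lam (Bracket (root_gen False j) x) f w = 0" if j: "j \<in> I" and "covec lam f" for j f w
  proof (rule Suc.IH[OF _ _ that(2)])
    show "lspan (nests True (Suc n)) (Bracket (root_gen False j) x)"
      using lspan_opposite_Suc[OF j, of True] Suc.prems(1) by simp
    show "rep lam (Bracket (root_gen False j) x) (vc lam []) w = 0" for lam w
      using Suc.prems(2) by (simp add: root_gen_def act_F_def)
  qed
  show ?case
    using Suc.prems(3)
  proof (induction w arbitrary: f)
    case Nil
    show ?case by (rule rep_span_True_Nil[OF Suc.prems(1)])
  next
    case (Cons j w)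
    show ?case
    proof (cases "j \<in> I")
      case True
      have "rep lam x (rep lam (Gen (F j)) f) w = 0"
        by (intro Cons.IH covec_F True Cons.prems)
      then show ?thesis using step[OF True Cons.prems, of w] by (simp add: root_gen_def act_F_def)
    next
      case False
      then show ?thesis
        using covec_words[OF covec_rep[OF lie_span_exprs[OF Suc.prems(1)] Cons.prems], of "j # w"]
        by auto
    qed
  qed
qed

lemma lowering_test:
  assumes "lspan (nests False (Suc n)) x" "\<And>lam u. u \<in> lists I \<Longrightarrow> rep lam x (vc lam u) [] = 0"
    "u \<in> lists I"
  shows "rep lam x (vc lam u) = (\<lambda>_. 0)"
  using assms
proof (induction n arbitrary: x u)
  case (0 x u)
  have step: "rep lam (Bracket (root_gen True i) x) f w = 0" if i: "i \<in> I" for i f w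
  proof (rule rep_span_coroot_zero[OF _ i])
    show "lspan {Gen (H (coroot i))} (Bracket (root_gen True i) x)"
      using lspan_opposite_1[OF i, of False] 0(1) by simp
    show "rep lam (Bracket (root_gen True i) x) (vc lam []) [] = 0" for lam
      using 0(2)[of "[i]" lam] i by (simp add: root_gen_def)
  qed
  show ?case
    using 0(3)
  proof (induction u rule: list.induct)
    case Nil
    show ?case by (rule rep_span_False_vac[OF 0(1)])
  next
    case (Cons i u)
    then have i: "i \<in> I" and IH: "rep lam x (vc lam u) = (\<lambda>_. 0)" by auto
    have "rep lam (Gen (E i)) (rep lam x (vc lam u)) = (\<lambda>_. 0)"
      unfolding IH by (rule rep_zero)
    then show ?case using step[OF i, of "vc lam u"] by (simp add: root_gen_def fun_eq_iff)
  qed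
next
  case (Suc n x u)
  \<comment> \<open>The bracket inherits the hypothesis: \<open>act_E\<close> vanishes at the empty
    word, so its value there is that of \<open>x\<close> applied to the functional for
    \<open>i # u\<close>.\<close>
  have step: "rep lam (Bracket (root_gen True i) x) (vc lam u) = (\<lambda>_. 0)"
    if i: "i \<in> I" and u: "u \<in> lists I" for i u
  proof (rule Suc.IH[OF _ _ u])
    show "lspan (nests False (Suc n)) (Bracket (root_gen True i) x)"
      using lspan_opposite_Suc[OF i, of False] Suc.prems(1) by simp
    show "rep lam (Bracket (root_gen True i) x) (vc lam u) [] = 0" if "u \<in> lists I" for lam u
      using Suc.prems(2)[of "i # u" lam] i that by (simp add: root_gen_def)
  qed
  show ?case
    using Suc.prems(3)
  proof (induction u rule: list.induct)
    case Nil
    show ?case by (rule rep_span_False_vac[OF Suc.prems(1)])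
  next
    case (Cons i u)
    then have i: "i \<in> I" and u: "u \<in> lists I" and IH: "rep lam x (vc lam u) = (\<lambda>_. 0)" by auto
    have "rep lam (Gen (E i)) (rep lam x (vc lam u)) = (\<lambda>_. 0)"
      unfolding IH by (rule rep_zero)
    then show ?case using step[OF i u] by (simp add: root_gen_def fun_eq_iff)
  qed
qed

text \<open>\<open>raising_test\<close> supplies a coefficient against the vacuum functional;
  weights then force \<open>w\<close> to have the content of \<open>v\<close>, hence only letters of
  \<open>v\<close>.\<close>

lemma nest_True_test:
  assumes v: "v \<in> lists I" and "nest True v \<notin> rad"
  obtains lam w where "w \<in> lists (set v)" "rep lam (nest True v) (vc lam []) w \<noteq> 0"
proof -
  have "v \<noteq> []"
    using assms(2) by (auto simp: rad_vac_iff)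
  then obtain n where n: "length v = Suc n" by (cases v) auto
  have "\<exists>lam w. rep lam (nest True v) (vc lam []) w \<noteq> 0"
  proof (rule ccontr)
    assume "\<not> ?thesis"
    then have "rep lam (nest True v) (vc lam u) w = 0" if "u \<in> lists I" for lam u w
      using raising_test[OF span_nest[OF v n] _ covec.vac[OF that]] by blast
    then show False using assms by (auto simp: rad_vac_iff)
  qed
  then obtain lam w where nz: "rep lam (nest True v) (vc lam []) w \<noteq> 0" by blast
  then have "content w k = content v k" for k
    using supp_nest_vac by (fastforce simp: sgi_def)
  then have "set w = set v" using content_nonzero_iff by (metis subsetI subset_antisym)
  then show ?thesis using that nz by (metis in_listsI)
qed

lemma nest_False_test:
  assumes v: "v \<in> lists I" and "nest False v \<notin> rad"
  obtains lam u where "u \<in> lists (set v)" "rep lam (nest False v) (vc lam u) [] \<noteq> 0"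
proof -
  have "v \<noteq> []"
    using assms(2) by (auto simp: rad_vac_iff)
  then obtain n where n: "length v = Suc n" by (cases v) auto
  have "\<exists>lam. \<exists>u\<in>lists I. rep lam (nest False v) (vc lam u) [] \<noteq> 0"
  proof (rule ccontr)
    assume "\<not> ?thesis"
    then have "rep lam (nest False v) (vc lam u) = (\<lambda>_. 0)" if "u \<in> lists I" for lam u
      using lowering_test[OF span_nest[OF v n] _ that] by blast
    then show False using assms by (auto simp: rad_vac_iff)
  qed
  then obtain lam u where nz: "rep lam (nest False v) (vc lam u) [] \<noteq> 0" by blast
  then have "content [] = (\<lambda>k. content u k + sgi False * content v k)"
    by (rule supp_nest_vac)
  then have "content u k = content v k" for k
    by (simp add: sgi_def fun_eq_iff)
  then have "set u = set v" using content_nonzero_iff by (metis subsetI subset_antisym)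
  then show ?thesis using that nz by (metis in_listsI)
qed

lemma word_weight_coroot:
  assumes "L \<subseteq> I" "w \<in> lists L" "i \<in> I"
  shows "wt lam w (coroot i) =
    (\<Sum>k<cartan_dim \<rho>. lam k * coroot i k) - (\<Sum>j\<in>L. of_int (content w j) * of_int (A i j))"
proof -
  have "ev (content w) (coroot i) = (\<Sum>j\<in>I. of_int (content w j) * of_int (A i j))"
    unfolding root_eval_def using realization assms(3)
    by (intro sum.cong) (auto simp: is_realization_def)
  also have "\<dots> = (\<Sum>j\<in>L. of_int (content w j) * of_int (A i j))"
    using assms fin content_nonzero_iff[of w]
    by (intro sum.mono_neutral_right) (auto dest: in_listsD)
  finally show ?thesis by (simp add: word_weight_def)
qed

end

section \<open>Passing to a subdiagram\<close>

text \<open>Words over \<open>L\<close> suffice, since \<open>act_E\<close> only deletes letters and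
  \<open>act_F i\<close> with \<open>i\<close> in \<open>L\<close> prepends one. Nests contain no
  Cartan generator, so weights enter only at simple coroots.\<close>

definition agree_on :: "'i set \<Rightarrow> ('i list \<Rightarrow> complex) \<Rightarrow> ('i list \<Rightarrow> complex) \<Rightarrow> bool" where
  "agree_on L f g \<longleftrightarrow> (\<forall>w\<in>lists L. f w = g w)"

context
  fixes I I' :: "'i set" and \<rho> \<rho>' :: "'i realization" and lam lam' :: "nat \<Rightarrow> complex" and L :: "'i set"
  assumes weights: "\<And>i w. i \<in> L \<Longrightarrow> w \<in> lists L \<Longrightarrow>
    word_weight I \<rho> lam w (simple_coroot \<rho> i) = word_weight I' \<rho>' lam' w (simple_coroot \<rho>' i)"
begin

lemma agree_on_root_gen:
  assumes "i \<in> L" "agree_on L f g"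
  shows "agree_on L (lie_act (km_act I \<rho> lam) (root_gen s i) f)
    (lie_act (km_act I' \<rho>' lam') (root_gen s i) g)"
  using assms weights unfolding agree_on_def
  by (auto simp: root_gen_def act_F_def intro!: act_E_agree[of L])

lemma agree_on_nest:
  assumes "v \<in> lists L" "agree_on L f g"
  shows "agree_on L (lie_act (km_act I \<rho> lam) (nest s v) f) (lie_act (km_act I' \<rho>' lam') (nest s v) g)"
  using assms
proof (induction s v arbitrary: f g rule: nest.induct)
  case (3 s i j u)
  then have i: "i \<in> L" and u: "j # u \<in> lists L" by auto
  show ?case
    using "3.IH"[OF u agree_on_root_gen[OF i "3.prems"(2), of s]]
      agree_on_root_gen[OF i "3.IH"[OF u "3.prems"(2)], of s]
    by (simp add: agree_on_def)
qed (auto simp: agree_on_root_gen, simp add: agree_on_def)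

lemma agree_on_vac: "u \<in> lists L \<Longrightarrow> agree_on L (vac I \<rho> lam u) (vac I' \<rho>' lam' u)"
proof (induction u rule: list.induct)
  case (Cons i u)
  then show ?case
    using agree_on_root_gen[of i "vac I \<rho> lam u" "vac I' \<rho>' lam' u" True] by (simp add: root_gen_def)
qed (simp add: agree_on_def)

end

text \<open>Outside the first radical there is a nonzero coefficient between words over
  \<open>L\<close>, and a highest weight with the same coroot values reproduces it in the second
  presentation. The statement is symmetric in the two diagrams, so it serves in both
  directions.\<close>

lemma nest_not_in_radical_transfer:
  assumes "km_presentation A I \<rho>" "km_presentation A I' \<rho>'" and L: "L \<subseteq> I" "L \<subseteq> I'"
    and v: "v \<in> lists L" and notin: "nest s v \<notin> km_radical I \<rho>"
  shows "nest s v \<notin> km_radical I' \<rho>'"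
proof -
  interpret K: km_presentation A I \<rho> by fact
  interpret K': km_presentation A I' \<rho>' by fact
  have vI: "v \<in> lists I" and LL: "lists (set v) \<subseteq> lists L"
    using v L by auto
  have "\<exists>lam'. \<forall>i\<in>L. \<forall>w\<in>lists L. word_weight I \<rho> lam w (simple_coroot \<rho> i) =
      word_weight I' \<rho>' lam' w (simple_coroot \<rho>' i)" for lam
  proof -
    obtain lam' :: "nat \<Rightarrow> complex" where lam': "\<And>i. i \<in> I' \<Longrightarrow>
        (\<Sum>k<cartan_dim \<rho>'. lam' k * simple_coroot \<rho>' i k) =
        (\<Sum>k<cartan_dim \<rho>. lam k * simple_coroot \<rho> i k)"
      using K'.coroot_dual[of "\<lambda>i. \<Sum>k<cartan_dim \<rho>. lam k * simple_coroot \<rho> i k"] by blast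
    then show ?thesis
      using L by (intro exI[of _ lam'] ballI)
        (simp add: K.word_weight_coroot[of L] K'.word_weight_coroot[of L] subset_iff)
  qed
  then have lam': "\<exists>lam'. \<forall>u\<in>lists L. \<forall>w\<in>lists L.
      lie_act (km_act I \<rho> lam) (nest s v) (vac I \<rho> lam u) w =
      lie_act (km_act I' \<rho>' lam') (nest s v) (vac I' \<rho>' lam' u) w" for lam
    using agree_on_nest[OF _ v agree_on_vac, of I \<rho> lam I' \<rho>'] unfolding agree_on_def by metis
  have "\<exists>lam. \<exists>u\<in>lists L. \<exists>w\<in>lists L. lie_act (km_act I \<rho> lam) (nest s v) (vac I \<rho> lam u) w \<noteq> 0"
  proof (cases s)
    case True
    have "nest True v \<notin> km_radical I \<rho>" using notin True by simp
    then obtain lam w where *: "w \<in> lists (set v)" "lie_act (km_act I \<rho> lam) (nest True v) (vac I \<rho> lam []) w \<noteq> 0"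
      by (rule K.nest_True_test[OF vI])
    show ?thesis
      by (rule exI[of _ lam], rule bexI[of _ "[]"], rule bexI[of _ w]) (use * LL True in auto)
  next
    case False
    have "nest False v \<notin> km_radical I \<rho>" using notin False by simp
    then obtain lam u where *: "u \<in> lists (set v)" "lie_act (km_act I \<rho> lam) (nest False v) (vac I \<rho> lam u) [] \<noteq> 0"
      by (rule K.nest_False_test[OF vI])
    show ?thesis
      by (rule exI[of _ lam], rule bexI[of _ u], rule bexI[of _ "[]"]) (use * LL False in auto)
  qed
  then obtain lam u w where u: "u \<in> lists L" and w: "w \<in> lists L"
    and nz: "lie_act (km_act I \<rho> lam) (nest s v) (vac I \<rho> lam u) w \<noteq> 0"
    by (elim exE bexE)
  from lam'[of lam] obtain lam' where
    eq: "\<forall>u\<in>lists L. \<forall>w\<in>lists L. lie_act (km_act I \<rho> lam) (nest s v) (vac I \<rho> lam u) w =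
      lie_act (km_act I' \<rho>' lam') (nest s v) (vac I' \<rho>' lam' u) w"
    by (elim exE)
  have nz': "lie_act (km_act I' \<rho>' lam') (nest s v) (vac I' \<rho>' lam' u) w \<noteq> 0"
    using nz bspec[OF bspec[OF eq u] w] by simp
  have "u \<in> lists I'" using u L(2) by auto
  then show ?thesis using K'.rad_vac[of "nest s v" u lam' w] nz' by blast
qed

lemma km_presentation_the_realization: "finite I \<Longrightarrow> km_presentation A I (the_realization A I)"
  by (simp add: km_presentation_def is_realization_the_realization)

section \<open>Roots of a diagram and of its subdiagrams\<close>

lemma roots_eq:
  assumes "finite I"
  shows "roots A I = {\<lambda>k. (if s then 1 else -1) * content v k |s v.
    v \<in> lists I \<and> nest s v \<notin> km_radical I (the_realization A I)}"
proof -
  interpret K: km_presentation A I "the_realization A I"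
    by (rule km_presentation_the_realization[OF assms])
  show ?thesis (is "_ = ?W")
  proof
    show "roots A I \<subseteq> ?W"
      using K.root_is_nest_weight unfolding roots_def K.sgi_def by blast
    show "?W \<subseteq> roots A I"
    proof
      fix \<alpha> assume "\<alpha> \<in> ?W"
      then obtain s v where \<alpha>: "\<alpha> = (\<lambda>k. K.sgi s * content v k)"
        and sv: "v \<in> lists I" "nest s v \<notin> K.rad"
        unfolding K.sgi_def by blast
      show "\<alpha> \<in> roots A I"
        unfolding \<alpha> roots_def using K.nest_weight_is_root[OF sv] sv by blast
    qed
  qed
qed

text \<open>The two radicals contain the same nests over \<open>L\<close>, and a content lies in the
  lattice of \<open>L\<close> exactly if the letters do.\<close>

lemma roots_subdiagram:
  assumes "finite I" "L \<subseteq> I"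
  shows "roots A L = roots A I \<inter> root_lattice L"
proof -
  have finL: "finite L" using assms finite_subset by blast
  note P = km_presentation_the_realization[OF finL, of A] km_presentation_the_realization[OF assms(1), of A]
  have iff: "nest s v \<notin> km_radical L (the_realization A L) \<longleftrightarrow>
      nest s v \<notin> km_radical I (the_realization A I)" if "v \<in> lists L" for s v
    using nest_not_in_radical_transfer[OF P _ _ that] nest_not_in_radical_transfer[OF P(2,1) _ _ that]
      assms(2) by blast
  have lattice: "(\<lambda>k. (if s then 1 else -1) * content v k) \<in> root_lattice L \<longleftrightarrow> v \<in> lists L" for s v
    using content_nonzero_iff[of v] by (auto simp: root_lattice_def in_lists_conv_set)
  have "lists L \<subseteq> lists I" using assms(2) by auto
  then show ?thesis
    unfolding roots_eq[OF assms(1)] roots_eq[OF finL] using iff lattice by blast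
qed

lemma roots_sign:
  assumes "finite I" "\<alpha> \<in> roots A I"
  shows "(\<forall>k. \<alpha> k \<ge> 0) \<or> (\<forall>k. \<alpha> k \<le> 0)"
proof -
  obtain s v where "\<alpha> = (\<lambda>k. (if s then 1 else -1) * content v k)"
    using assms by (auto simp: roots_eq)
  then show ?thesis by (cases s) (simp_all add: content_nonneg)
qed

section \<open>Real roots of a subdiagram\<close>

lemma reflection_subdiagram:
  assumes "finite I" "L \<subseteq> I" "\<alpha> \<in> root_lattice L"
  shows "reflection A I i \<alpha> = reflection A L i \<alpha>"
proof -
  have "(\<Sum>k\<in>I. A i k * \<alpha> k) = (\<Sum>k\<in>L. A i k * \<alpha> k)"
    using assms by (intro sum.mono_neutral_right) (auto simp: root_lattice_def)
  then show ?thesis by (simp add: reflection_def)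
qed

text \<open>Reflections for \<open>I\<close> and \<open>L\<close> may differ off the lattice of
  \<open>L\<close>, where the sum over \<open>I\<close> sees further coordinates. Agreement is thus
  claimed on that lattice, whose stability is carried through the induction.\<close>

lemma weyl_group_subdiagram:
  assumes I: "finite I" "L \<subseteq> I" and w: "w \<in> weyl_group A L"
  shows "\<exists>w'\<in>weyl_group A I. \<forall>\<alpha>\<in>root_lattice L. w' \<alpha> = w \<alpha> \<and> w \<alpha> \<in> root_lattice L"
  using w
proof (induction rule: weyl_group.induct)
  case one
  show ?case using weyl_group.one by (intro bexI[of _ id]) auto
next
  case (mult i w)
  then obtain w' where w': "w' \<in> weyl_group A I"
    "\<forall>\<alpha>\<in>root_lattice L. w' \<alpha> = w \<alpha> \<and> w \<alpha> \<in> root_lattice L" by blast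
  have "reflection A L i \<alpha> \<in> root_lattice L" if "\<alpha> \<in> root_lattice L" for \<alpha>
    using that mult.hyps(1) by (auto simp: root_lattice_def reflection_def simple_root_def)
  then show ?case
    using w' mult.hyps(1) I weyl_group.mult[of i I w' A] reflection_subdiagram[OF I]
    by (intro bexI[of _ "reflection A I i \<circ> w'"]) auto
qed

lemma real_roots_subdiagram:
  assumes I: "finite I" "L \<subseteq> I"
  shows "real_roots A L \<subseteq> real_roots A I"
proof
  fix \<alpha> assume "\<alpha> \<in> real_roots A L"
  then obtain w i where \<alpha>: "\<alpha> \<in> roots A L" and w: "w \<in> weyl_group A L" "i \<in> L" "w \<alpha> = simple_root i"
    by (auto simp: real_roots_def)
  then have "\<alpha> \<in> roots A I" "\<alpha> \<in> root_lattice L" using roots_subdiagram[OF I] by auto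
  then show "\<alpha> \<in> real_roots A I"
    using weyl_group_subdiagram[OF I w(1)] w I by (fastforce simp: real_roots_def)
qed

lemma positive_real_roots_disjoint_diff_not_root:
  assumes "finite I" "L \<inter> L' = {}"
    and \<beta>: "\<beta> \<in> positive_real_roots A L" and \<gamma>: "\<gamma> \<in> positive_real_roots A L'"
  shows "(\<lambda>i. \<beta> i - \<gamma> i) \<notin> roots A I"
proof
  assume root: "(\<lambda>i. \<beta> i - \<gamma> i) \<in> roots A I"
  have pos: "\<exists>i\<in>M. \<delta> i > 0 \<and> (\<forall>k. k \<notin> M \<longrightarrow> \<delta> k = 0)" if "\<delta> \<in> positive_real_roots A M" for \<delta> M
  proof -
    have \<delta>: "\<delta> \<in> root_lattice M" "\<delta> \<noteq> (\<lambda>_. 0)" "\<forall>i\<in>M. 0 \<le> \<delta> i"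
      using that by (auto simp: positive_real_roots_def real_roots_def roots_def)
    then obtain i where "\<delta> i \<noteq> 0" by blast
    with \<delta> show ?thesis unfolding root_lattice_def by (intro bexI[of _ i]) force+
  qed
  obtain i where i: "i \<in> L" "\<beta> i > 0" "\<And>k. k \<notin> L \<Longrightarrow> \<beta> k = 0" using pos[OF \<beta>] by blast
  obtain j where j: "j \<in> L'" "\<gamma> j > 0" "\<And>k. k \<notin> L' \<Longrightarrow> \<gamma> k = 0" using pos[OF \<gamma>] by blast
  have "\<gamma> i = 0" "\<beta> j = 0" using i j assms(2) by blast+
  then have "\<beta> i - \<gamma> i > 0" "\<beta> j - \<gamma> j < 0" using i j by auto
  then show False using roots_sign[OF assms(1) root] by (meson not_less)
qed

lemma pi_system_subdiagram:
  assumes "finite I" "L \<subseteq> I"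
  shows "pi_system A L S \<Longrightarrow> pi_system A I S"
proof -
  assume S: "pi_system A L S"
  have lattice: "\<beta> \<in> root_lattice L" if "\<beta> \<in> S" for \<beta>
    using S that by (auto simp: pi_system_def real_roots_def roots_def)
  then have "(\<lambda>i. \<beta> i - \<gamma> i) \<in> root_lattice L" if "\<beta> \<in> S" "\<gamma> \<in> S" for \<beta> \<gamma>
    using lattice[OF that(1)] lattice[OF that(2)] by (simp add: root_lattice_def)
  then show ?thesis
    using S roots_subdiagram[OF assms, of A] real_roots_subdiagram[OF assms, of A]
    unfolding pi_system_def by blast
qed

theorem mainTheorem4:
  fixes A :: "'i \<Rightarrow> 'i \<Rightarrow> int"
    and X \<Lambda> \<Lambda>' :: "'i set"
    and \<Sigma> \<Sigma>' :: "('i \<Rightarrow> int) set"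
  assumes "gcm A X"
    and "symmetrizable A X"
    and "\<Lambda> \<subset> X"
    and "\<Lambda>' = X - \<Lambda>"
    and "pi_system A \<Lambda> \<Sigma>"
    and "\<Sigma> \<subseteq> positive_real_roots A \<Lambda>"
    and "pi_system A \<Lambda>' \<Sigma>'"
    and "\<Sigma>' \<subseteq> positive_real_roots A \<Lambda>'"
  shows "pi_system A X (\<Sigma> \<union> \<Sigma>')"
proof -
  have fin: "finite X" using assms(1) by (simp add: gcm_def)
  have "pi_system A X \<Sigma>"
    using assms by (intro pi_system_subdiagram[OF fin, of \<Lambda>]) auto
  moreover have "pi_system A X \<Sigma>'"
    using assms by (intro pi_system_subdiagram[OF fin, of \<Lambda>']) auto
  \<comment> \<open>Both differences are covered, since a mixed pair of the union occurs in either
    order.\<close>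
  moreover have "(\<lambda>i. \<beta> i - \<gamma> i) \<notin> roots A X \<and> (\<lambda>i. \<gamma> i - \<beta> i) \<notin> roots A X"
    if "\<beta> \<in> \<Sigma>" "\<gamma> \<in> \<Sigma>'" for \<beta> \<gamma>
  proof -
    have "\<beta> \<in> positive_real_roots A \<Lambda>" "\<gamma> \<in> positive_real_roots A \<Lambda>'" "\<Lambda> \<inter> \<Lambda>' = {}"
      using that assms by auto
    then show ?thesis
      using positive_real_roots_disjoint_diff_not_root[OF fin] by (metis Int_commute)
  qed
  ultimately show ?thesis
    unfolding pi_system_def by blast
qed

end
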